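(* Consider the additive error model $O^{AE}$ with error distribution $E\in\mathcal P(\mathbb R^{\dim(\Xi)})$ whose characteristic function $\varphi_E(t)=\int\exp(i\langle t,e\rangle)\,dE(e)$ has no roots, i.e. $\varphi_E(t)\neq0$ for all $t\in\mathbb R^{\dim(\Xi)}$. Let $P\in\mathcal P$ and assume that $P'=O^{AE}\star P$ has bounded fourth order moment. Assume that the loss $\ell$ is uniformly bounded and Lipschitz: there are $L>0$ and $\mathcal L>0$ with $\sup_{\xi\in\Xi}|\ell(z,\xi)|\le L$ for all $z\in Z$ and $\sup_{z\in Z,\ \xi_1\ne\xi_2\in\Xi}\frac{|\ell(z,\xi_1)-\ell(z,\xi_2)|}{\|\xi_1-\xi_2\|}\le\mathcal L$. Let $r_N>0$ and $\delta_N>0$ decay to zero with $r_N=\Omega(N^{\gamma-1})$ and $\delta_N=\Omega(N^{-\gamma'/(2\dim(\Xi'))})$ for some $0<\gamma'<\gamma<1$. Let $\epsilon>0$ and $$\tilde c_N(z,P'_N)=\sup\{\mathbf E_Q[\ell(z,\xi)]: Q\in\mathcal P,\ I^{\delta_N}(P'_N,Q)\le r_N\},\qquad \tilde z_N(P'_N)\in\arg_\epsilon\inf_{z\in Z}\tilde c_N(z,P'_N).$$ Then $$\lim_{N\to\infty}\mathrm{Prob}\left[\mathbf E_P[\ell(\tilde z_N(P'_N),\xi)]\le\inf_{z\in Z}\mathbf E_P[\ell(z,\xi)]+2\epsilon\right]=1 .$$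
   Context: $\Xi\subseteq\mathbb R^{\dim(\Xi)}$ and $\Xi'=\mathbb R^{\dim(\Xi)}$ (so $\dim(\Xi')=\dim(\Xi)$), with norm $\|\cdot\|$. $\mathcal P(\cdot)$ denotes Borel probability measures, $\mathcal P\subseteq\mathcal P(\Xi)$ is a given family, $Z$ is a decision set and $\ell:Z\times\Xi\to\mathbb R$ a loss function. Additive error model: $O^{AE}_\xi$ is the law of $\xi+e$ with $e\sim E$, i.e. $O^{AE}_\xi(B)=\int\mathbb 1\{\xi+e\in B\}\,dE(e)$; and $(O^{AE}\star Q)(B)=\int O^{AE}_\xi(B)\,dQ(\xi)$. The noisy observations $\xi'_1,\dots,\xi'_N$ are i.i.d. with law $P'=O^{AE}\star P$, and $P'_N=\frac1N\sum_{i=1}^N\delta_{\xi'_i}$. $I(\hat P',Q)=\mathrm{KL}(\hat P',O^{AE}\star Q)$, with $\mathrm{KL}$ the Kullback–Leibler divergence ($+\infty$ if the first argument is not absolutely continuous with respect to the second), and $I^\delta(\mu,\nu)=\inf\{I(\upsilon,\nu):\upsilon\in\mathcal P(\Xi'),\ \mathrm{LP}(\upsilon,\mu)\le\delta\}$, where $\mathrm{LP}$ is the Lévy–Prokhorov metric on $\mathcal P(\Xi')$ associated with $\|\cdot\|$. $\arg_\epsilon\inf_{z\in Z}f(z)=\{z\in Z:f(z)<\inf_{z'\in Z}f(z')+\epsilon\}$; a supremum over the empty set is $-\infty$. $a_N=\Omega(b_N)$ means $a_N\ge C b_N$ for some constant $C>0$ and all large $N$. *)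

theory Defs
  imports "HOL-Probability.Probability" "HOL-Library.Landau_Symbols"
begin

definition is_norm :: "('a::real_vector \<Rightarrow> real) \<Rightarrow> bool" where
  "is_norm nrm \<longleftrightarrow>
     (\<forall>x. nrm x = 0 \<longleftrightarrow> x = 0) \<and>
     (\<forall>c x. nrm (c *\<^sub>R x) = \<bar>c\<bar> * nrm x) \<and>
     (\<forall>x y. nrm (x + y) \<le> nrm x + nrm y)"

(* Elements are measures whose underlying space is S itself, with the Borel
   sigma-algebra of the subspace topology; S need not be a Borel set. *)
definition borel_probs :: "'a::topological_space set \<Rightarrow> 'a measure set" where
  "borel_probs S = space (prob_algebra (restrict_space borel S))"

definition char_fun :: "'a::euclidean_space measure \<Rightarrow> 'a \<Rightarrow> complex" where
  "char_fun E t = (CLINT e|E. exp (\<i> * complex_of_real (t \<bullet> e)))"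

definition additive_error :: "'a::euclidean_space measure \<Rightarrow> 'a \<Rightarrow> 'a measure" where
  "additive_error E \<xi> = distr E borel (\<lambda>e. \<xi> + e)"

(* The law of the noisy observation, written with the monadic bind of kernels;
   emeasure_noisy_law below is the integral formula. *)
definition noisy_law :: "'a::euclidean_space measure \<Rightarrow> 'a measure \<Rightarrow> 'a measure" where
  "noisy_law E Q = Q \<bind> additive_error E"

lemma emeasure_additive_error:
  assumes "E \<in> borel_probs UNIV" "B \<in> sets borel"
  shows "emeasure (additive_error E \<xi>) B = (\<integral>\<^sup>+e. indicator B (\<xi> + e) \<partial>E)"
proof -
  have [measurable_cong, simp]: "sets E = sets borel"
    using assms(1) by (simp add: borel_probs_def space_prob_algebra)
  show ?thesis
    using assms(2) unfolding additive_error_def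
    by (subst nn_integral_indicator[symmetric], simp, subst nn_integral_distr) auto
qed

lemma emeasure_noisy_law:
  fixes E :: "'a::euclidean_space measure"
  assumes E: "E \<in> borel_probs UNIV" and Q: "Q \<in> borel_probs \<Xi>" and B: "B \<in> sets borel"
  shows "emeasure (noisy_law E Q) B = (\<integral>\<^sup>+\<xi>. emeasure (additive_error E \<xi>) B \<partial>Q)"
proof -
  have E': "E \<in> space (prob_algebra borel)" and sE[measurable_cong]: "sets E = sets borel"
    using E by (auto simp: borel_probs_def space_prob_algebra)
  have sQ: "sets Q = sets (restrict_space borel \<Xi>)" and pQ: "prob_space Q"
    using Q by (auto simp: borel_probs_def space_prob_algebra)
  have "additive_error E \<in> borel \<rightarrow>\<^sub>M prob_algebra borel"
    unfolding additive_error_def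
    by (rule measurable_distr_prob_space2[OF measurable_const[OF E'] _])
       measurable
  then have "additive_error E \<in> restrict_space borel \<Xi> \<rightarrow>\<^sub>M subprob_algebra borel"
    by (intro measurable_restrict_space1 measurable_prob_algebraD)
  then have "additive_error E \<in> Q \<rightarrow>\<^sub>M subprob_algebra borel"
    by (simp cong: measurable_cong_sets add: measurable_cong_sets[OF sQ refl])
  then show ?thesis
    unfolding noisy_law_def
    by (rule emeasure_bind[OF prob_space.not_empty[OF pQ] _ B])
qed

(* The law of x I with I uniform on {0..<N}, that is, the average of the N Dirac
   measures at x 0, ..., x (N - 1). *)
definition empirical :: "nat \<Rightarrow> (nat \<Rightarrow> 'a::topological_space) \<Rightarrow> 'a measure" where
  "empirical N x = distr (uniform_count_measure {..<N}) borel x"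

lemma measure_empirical:
  assumes "N > 0" "B \<in> sets borel"
  shows "measure (empirical N x) B = (\<Sum>i<N. indicator B (x i)) / real N"
proof -
  have "measure (empirical N x) B = measure (uniform_count_measure {..<N}) (x -` B \<inter> {..<N})"
    unfolding empirical_def using assms
    by (subst measure_distr)
       (auto simp: space_uniform_count_measure measurable_def sets_uniform_count_measure)
  also have "\<dots> = real (card (x -` B \<inter> {..<N})) / real N"
    by (subst measure_uniform_count_measure) auto
  also have "real (card (x -` B \<inter> {..<N})) = (\<Sum>i<N. indicator B (x i))"
    by (simp add: indicator_def sum.If_cases vimage_def Int_def conj_commute)
  finally show ?thesis .
qed

(* The library's KL_divergence is real-valued with the reference measure first. If mu is
   absolutely continuous w.r.t. nu, the negative part of the log-density is always
   mu-integrable, so failure of integrability means that the divergence is infinite. *)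
definition KL :: "'a measure \<Rightarrow> 'a measure \<Rightarrow> ereal" where
  "KL \<mu> \<nu> =
     (if absolutely_continuous \<nu> \<mu> \<and> integrable \<mu> (entropy_density (exp 1) \<nu> \<mu>)
      then ereal (KL_divergence (exp 1) \<nu> \<mu>) else \<infinity>)"

definition LP :: "('a::euclidean_space \<Rightarrow> real) \<Rightarrow> 'a measure \<Rightarrow> 'a measure \<Rightarrow> real" where
  "LP nrm \<mu> \<nu> = Inf {e. e > 0 \<and> (\<forall>A\<in>sets borel.
      measure \<mu> A \<le> measure \<nu> {x. \<exists>a\<in>A. nrm (x - a) < e} + e \<and>
      measure \<nu> A \<le> measure \<mu> {x. \<exists>a\<in>A. nrm (x - a) < e} + e)}"

definition rate :: "'a::euclidean_space measure \<Rightarrow> 'a measure \<Rightarrow> 'a measure \<Rightarrow> ereal" where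
  "rate E \<mu>' Q = KL \<mu>' (noisy_law E Q)"

definition smoothed_rate ::
  "('a::euclidean_space \<Rightarrow> real) \<Rightarrow> 'a measure \<Rightarrow> real \<Rightarrow> 'a measure \<Rightarrow> 'a measure \<Rightarrow> ereal" where
  "smoothed_rate nrm E \<delta> \<mu> Q =
     (INF \<upsilon> \<in> {\<upsilon> \<in> borel_probs UNIV. LP nrm \<upsilon> \<mu> \<le> \<delta>}. rate E \<upsilon> Q)"

definition robust_cost ::
  "('a::euclidean_space \<Rightarrow> real) \<Rightarrow> 'a measure \<Rightarrow> 'a measure set \<Rightarrow> ('z \<Rightarrow> 'a \<Rightarrow> real) \<Rightarrow>
   real \<Rightarrow> real \<Rightarrow> 'a measure \<Rightarrow> 'z \<Rightarrow> ereal" where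
  "robust_cost nrm E \<P> \<l> r \<delta> \<mu> z =
     (SUP Q \<in> {Q \<in> \<P>. smoothed_rate nrm E \<delta> \<mu> Q \<le> ereal r}. ereal (\<integral>\<xi>. \<l> z \<xi> \<partial>Q))"

definition arg_eps_inf :: "real \<Rightarrow> 'z set \<Rightarrow> ('z \<Rightarrow> ereal) \<Rightarrow> 'z set" where
  "arg_eps_inf \<epsilon> Z f = {z \<in> Z. f z < (INF z'\<in>Z. f z') + ereal \<epsilon>}"

(* Inner probability: an arbitrary selection of decisions need not be measurable in the
   data. On measurable events it is the probability. *)
definition inner_prob :: "'w measure \<Rightarrow> 'w set \<Rightarrow> real" where
  "inner_prob M A = (SUP B \<in> {B \<in> sets M. B \<subseteq> A}. measure M B)"

lemma inner_prob_eq_measure: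
  assumes "prob_space M" "A \<in> sets M"
  shows "inner_prob M A = measure M A"
proof -
  interpret prob_space M by fact
  show ?thesis
    unfolding inner_prob_def using assms(2)
    by (intro cSup_eq_maximum) (auto intro: finite_measure_mono)
qed

end

theory Submission
  imports Defs
begin

text \<open>
  Two facts carry the theorem. With probability tending to one the true law \<open>P\<close> is feasible, that is, it
  satisfies the constraint that defines \<open>robust_cost\<close>; and as soon as \<open>P\<close> is feasible and
  \<open>r N\<close>, \<open>\<delta> N\<close> are small, every feasible \<open>Q\<close> has expected losses within
  \<open>\<epsilon>\<close> of those of \<open>P\<close>, uniformly over the decisions. The robust cost of a decision then lies between
  its true expected loss and that loss plus \<open>\<epsilon>\<close>, so an \<open>\<epsilon>\<close>-minimizer of the robust cost is a
  \<open>2 * \<epsilon>\<close>-minimizer of the true expected loss (\<open>near_optimal_decision\<close>).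

  Feasibility of \<open>P\<close> (\<open>true_law_feasible_whp\<close>). Write \<open>\<nu> = noisy_law E P\<close> and
  \<open>d = DIM('a)\<close>. Cut a box of radius about \<open>\<delta> powr (-1/2)\<close> into cells of diameter less than
  \<open>\<delta>\<close> and let one further cell collect the outside (\<open>quantizer_exists\<close>). Redistribute the empirical mass
  of each cell according to \<open>\<nu>\<close> conditioned on that cell. The resulting law is
  within Levy-Prokhorov distance \<open>\<delta>\<close> of the empirical law provided that the outer cell has
  empirical mass at most \<open>\<delta>\<close>, and its divergence from \<open>\<nu>\<close> is at most the chi-square
  statistic of the cell counts (\<open>chi_square_small_imp_feasible\<close>). The expectation of that statistic is at
  most the number of cells divided by \<open>N\<close>. There are of the order of
  \<open>\<delta> powr (- 3 * d / 2)\<close> cells, which for the smallest admissible \<open>\<delta>\<close> is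
  \<open>N powr (3 * \<gamma>' / 4)\<close> and hence negligible against \<open>N * r N\<close>, while the fourth moment makes
  the outer cell negligible. Markov's inequality finishes this half.

  Agreement of feasible laws (\<open>feasible_laws_agree\<close>). A small smoothed rate places \<open>noisy_law E Q\<close>
  near the empirical law when tested against bounded Lipschitz functions: a small divergence gives a small total
  variation, and a small Levy-Prokhorov distance controls Lipschitz tests. If both \<open>P\<close> and \<open>Q\<close> are
  feasible, the characteristic functions of \<open>noisy_law E P\<close> and \<open>noisy_law E Q\<close> are therefore
  close on every ball. They are those of \<open>P\<close> and \<open>Q\<close> multiplied by \<open>char_fun E\<close>,
  which has no zeros and so can be divided out off a set of small Gaussian measure. It remains to pass from
  characteristic functions that are close in Gaussian mean to expectations that are close uniformly over a class of
  bounded Lipschitz functions. Smoothing by a Gaussian does this quantitatively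
  (\<open>char_fun_gap_controls_lipschitz_gap\<close>): it moves Lipschitz expectations by little, and since the
  Gaussian is its own Fourier transform, the smoothed densities are uniformly close; on a large ball this makes them
  close in mean, and as both have total mass one, Scheffe's argument covers the complement.
\<close>

section \<open>Gaussian densities and their characteristic functions\<close>

lemma lborel_eq_PiM: "(lborel :: 'a::euclidean_space measure) =
    distr (\<Pi>\<^sub>M b\<in>(Basis :: 'a set). (lborel :: real measure)) borel (\<lambda>f. \<Sum>b\<in>Basis. f b *\<^sub>R b)"
  by (subst lborel_def) (simp add: lborel_eq_real)

text \<open>
  Lebesgue measure on a Euclidean space is the image of a product of one-dimensional Lebesgue measures, so
  functions that factor over the coordinates can be integrated one coordinate at a time.
\<close>

lemma
  fixes h :: "'a::euclidean_space \<Rightarrow> real \<Rightarrow> 'c::{real_normed_field,banach,second_countable_topology}"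
  assumes h: "\<And>b. b \<in> Basis \<Longrightarrow> integrable lborel (h b)"
  shows integrable_lborel_prod: "integrable lborel (\<lambda>x::'a. \<Prod>b\<in>Basis. h b (x \<bullet> b))" (is ?A)
    and integral_lborel_prod:
      "(\<integral>x. (\<Prod>b\<in>Basis. h b ((x::'a) \<bullet> b)) \<partial>lborel) = (\<Prod>b\<in>Basis. \<integral>y. h b y \<partial>lborel)" (is ?B)
proof -
  interpret product_sigma_finite "\<lambda>_::'a. lborel :: real measure" ..
  have hm: "h b \<in> borel_measurable borel" if "b \<in> Basis" for b
    using borel_measurable_integrable[OF h[OF that]] by simp
  have meas [measurable]: "(\<lambda>x::'a. \<Prod>b\<in>Basis. h b (x \<bullet> b)) \<in> borel_measurable borel"
    by (intro borel_measurable_prod measurable_compose[OF _ hm]) auto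
  have eq: "(\<Prod>b\<in>Basis. h b ((\<Sum>b'\<in>Basis. f b' *\<^sub>R b') \<bullet> b)) = (\<Prod>b\<in>Basis. h b (f b))" for f
    by (intro prod.cong refl) simp
  show ?A
    by (subst lborel_eq_PiM, subst integrable_distr_eq)
       (use product_integrable_prod[OF finite_Basis h] in \<open>simp_all add: eq\<close>)
  show ?B
    by (subst lborel_eq_PiM, subst integral_distr)
       (use product_integral_prod[OF finite_Basis h] in \<open>simp_all add: eq\<close>)
qed

definition gauss :: "'a::euclidean_space \<Rightarrow> real" where
  "gauss u = (\<Prod>b\<in>Basis. std_normal_density (u \<bullet> b))"

definition gauss_measure :: "'a::euclidean_space measure" where
  "gauss_measure = density lborel gauss"

lemma gauss_measurable [measurable]: "gauss \<in> borel_measurable borel"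
  unfolding gauss_def by measurable

lemma gauss_nonneg [simp]: "gauss u \<ge> 0"
  unfolding gauss_def by (intro prod_nonneg) simp

lemma power2_norm_eq_sum_Basis: "(norm u)\<^sup>2 = (\<Sum>b\<in>Basis. ((u::'a::euclidean_space) \<bullet> b)\<^sup>2)"
  by (subst power2_norm_eq_inner, subst euclidean_inner) (simp add: power2_eq_square)

lemma gauss_eq: "gauss (u::'a::euclidean_space) = gauss (0::'a) * exp (- (norm u)\<^sup>2 / 2)"
proof -
  have "exp (- (norm u)\<^sup>2 / 2) = (\<Prod>b\<in>Basis. exp (- (u \<bullet> b)\<^sup>2 / 2))"
    by (simp add: power2_norm_eq_sum_Basis exp_sum[symmetric] sum_negf sum_divide_distrib)
  then show ?thesis
    by (simp add: gauss_def std_normal_density_def prod_dividef power_one_over)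
qed

lemma integrable_gauss [simp]: "integrable lborel gauss"
  using integrable_lborel_prod[of "\<lambda>_. std_normal_density"] integrable_std_normal_moment[of 0]
  unfolding gauss_def by simp

lemma integral_gauss: "(\<integral>u. gauss u \<partial>lborel) = 1"
  using integral_lborel_prod[of "\<lambda>_. std_normal_density"] integrable_std_normal_moment[of 0]
    integral_std_normal_moment_even[of 0]
  unfolding gauss_def by simp

text \<open>
  The norm is at most the sum of the coordinate sizes, and each coordinate size times the density factors
  over the coordinates.
\<close>

lemma integrable_norm_gauss: "integrable lborel (\<lambda>u::'a::euclidean_space. norm u * gauss u)"
proof -
  have 1: "integrable lborel (\<lambda>u::'a. \<bar>u \<bullet> c\<bar> * gauss u)" if "c \<in> Basis" for c
  proof -
    define h where "h = (\<lambda>b y. if b = c then std_normal_density y * \<bar>y\<bar> ^ 1 else std_normal_density y * \<bar>y\<bar> ^ 0)"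
    have "integrable lborel (h b)" for b
      unfolding h_def by (cases "b = c")
        (use integrable_std_normal_moment_abs[of 0] integrable_std_normal_moment_abs[of 1] in simp_all)
    then have "integrable lborel (\<lambda>x::'a. \<Prod>b\<in>Basis. h b (x \<bullet> b))"
      by (rule integrable_lborel_prod)
    also have "(\<lambda>x::'a. \<Prod>b\<in>Basis. h b (x \<bullet> b)) = (\<lambda>u::'a. \<bar>u \<bullet> c\<bar> * gauss u)"
      unfolding gauss_def using that
      by (intro ext, subst (1 2) prod.remove[of _ c]) (auto simp: h_def intro!: prod.cong)
    finally show ?thesis .
  qed
  show ?thesis
  proof (rule Bochner_Integration.integrable_bound)
    show "integrable lborel (\<lambda>u::'a. \<Sum>c\<in>Basis. \<bar>u \<bullet> c\<bar> * gauss u)"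
      using 1 by (intro Bochner_Integration.integrable_sum)
    show "AE u in lborel. norm (norm u * gauss u) \<le> norm (\<Sum>c\<in>Basis. \<bar>u \<bullet> c\<bar> * gauss (u::'a))"
      by (auto simp: sum_distrib_right[symmetric] abs_mult sum_nonneg intro!: mult_right_mono norm_le_l1)
  qed simp
qed

lemma sets_gauss_measure [simp, measurable_cong]: "sets gauss_measure = sets borel"
  and space_gauss_measure [simp]: "space gauss_measure = UNIV"
  by (simp_all add: gauss_measure_def)

lemma prob_space_gauss_measure: "prob_space (gauss_measure :: 'a::euclidean_space measure)"
proof
  show "emeasure (gauss_measure :: 'a measure) (space gauss_measure) = 1"
    by (simp add: gauss_measure_def emeasure_density nn_integral_eq_integral integral_gauss)
qed

lemma char_fun_gauss:
  "char_fun gauss_measure (t :: 'a::euclidean_space) = complex_of_real (exp (- (norm t)\<^sup>2 / 2))"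
proof -
  define h where "h = (\<lambda>b y. complex_of_real (std_normal_density y) * exp (\<i> * complex_of_real ((t \<bullet> b) * y)))"
  have N: "prob_space std_normal_distribution"
    using real_dist_normal_dist by (simp add: real_distribution_def)
  then interpret N: prob_space std_normal_distribution .
  have sum: "t \<bullet> x = (\<Sum>b\<in>Basis. (t \<bullet> b) * (x \<bullet> b))" for x
    by (rule euclidean_inner)
  have hi: "integrable lborel (h b)" for b
    unfolding h_def
    by (rule Bochner_Integration.integrable_bound[where f=std_normal_density])
       (use integrable_std_normal_moment[of 0] in \<open>simp_all add: norm_mult\<close>)
  have h1: "(\<integral>y. h b y \<partial>lborel) = complex_of_real (exp (- (t \<bullet> b)\<^sup>2 / 2))" for b
  proof -
    have "(\<integral>y. h b y \<partial>lborel) = char std_normal_distribution (t \<bullet> b)"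
      unfolding h_def char_def
      by (subst integral_density) (simp_all add: scaleR_conv_of_real)
    then show ?thesis by (simp add: char_std_normal_distribution)
  qed
  have "char_fun gauss_measure t = (\<integral>x. complex_of_real (gauss x) * exp (\<i> * complex_of_real (t \<bullet> x)) \<partial>lborel)"
    unfolding char_fun_def gauss_measure_def
    by (subst integral_density) (simp_all add: scaleR_conv_of_real)
  also have "\<dots> = (\<integral>x. (\<Prod>b\<in>Basis. h b (x \<bullet> b)) \<partial>lborel)"
    unfolding gauss_def h_def
    by (subst sum) (simp add: prod.distrib exp_sum[symmetric] sum_distrib_left)
  also have "\<dots> = (\<Prod>b\<in>Basis. complex_of_real (exp (- (t \<bullet> b)\<^sup>2 / 2)))"
    by (subst integral_lborel_prod[OF hi]) (simp add: h1)
  also have "\<dots> = complex_of_real (exp (\<Sum>b\<in>Basis. - (t \<bullet> b)\<^sup>2 / 2))"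
    by (simp add: exp_sum)
  also have "(\<Sum>b\<in>Basis. - (t \<bullet> b)\<^sup>2 / 2) = - (norm t)\<^sup>2 / 2"
    by (simp add: power2_norm_eq_sum_Basis sum_negf sum_divide_distrib)
  finally show ?thesis .
qed

section \<open>Gaussian smoothing and quantitative deconvolution\<close>

lemma char_fun_measurable [measurable]:
  assumes "prob_space Q" and [measurable_cong]: "sets Q = sets (borel :: 'a::euclidean_space measure)"
  shows "char_fun Q \<in> borel_measurable borel"
proof -
  interpret prob_space Q by fact
  show ?thesis unfolding char_fun_def by measurable
qed

lemma norm_char_fun_le:
  assumes "prob_space Q"
  shows "norm (char_fun Q t) \<le> 1"
proof -
  interpret prob_space Q by fact
  have "norm (char_fun Q t) \<le> (\<integral>e. norm (exp (\<i> * complex_of_real (t \<bullet> e))) \<partial>Q)"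
    unfolding char_fun_def by (rule integral_norm_bound)
  then show ?thesis by (simp add: prob_space)
qed

lemma integrable_diff_char_fun:
  fixes P Q :: "'a::euclidean_space measure"
  assumes "prob_space M" "sets M = sets (borel :: 'a measure)"
    and P: "prob_space P" "sets P = sets borel" and Q: "prob_space Q" "sets Q = sets borel"
  shows "integrable M (\<lambda>t. norm (char_fun Q (s *\<^sub>R t) - char_fun P (s *\<^sub>R t)))"
proof -
  interpret prob_space M by fact
  note [measurable_cong] = assms(2)
  note [measurable] = char_fun_measurable[OF P] char_fun_measurable[OF Q]
  show ?thesis
  proof (rule integrable_const_bound[of _ 2])
    show "AE t in M. norm (norm (char_fun Q (s *\<^sub>R t) - char_fun P (s *\<^sub>R t))) \<le> 2"
      using norm_char_fun_le[OF P(1)] norm_char_fun_le[OF Q(1)]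
      by (intro AE_I2) (smt (verit, best) norm_triangle_ineq4 norm_ge_zero real_norm_def)
  qed measurable
qed

text \<open>
  The Lebesgue density of the convolution of \<open>Q\<close> with the standard Gaussian.
\<close>

definition smoothed_density :: "'a::euclidean_space measure \<Rightarrow> 'a \<Rightarrow> real" where
  "smoothed_density Q y = (\<integral>x. gauss (y - x) \<partial>Q)"

lemma lborel_integral_translate:
  fixes f :: "'a::euclidean_space \<Rightarrow> real"
  assumes [measurable]: "f \<in> borel_measurable borel"
  shows "(\<integral>y. f y \<partial>lborel) = (\<integral>u. f (x + u) \<partial>lborel)"
    and "integrable lborel f \<longleftrightarrow> integrable lborel (\<lambda>u. f (x + u))"
proof -
  have d: "lborel = distr lborel borel (\<lambda>u. x + u)"
    by (simp add: lborel_distr_plus)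
  show "(\<integral>y. f y \<partial>lborel) = (\<integral>u. f (x + u) \<partial>lborel)"
    by (subst d, subst integral_distr) auto
  show "integrable lborel f \<longleftrightarrow> integrable lborel (\<lambda>u. f (x + u))"
    by (subst d, subst integrable_distr_eq) auto
qed

lemma gauss_translate:
  fixes x :: "'a::euclidean_space"
  shows "integrable lborel (\<lambda>y. gauss (y - x))" "(\<integral>y. gauss (y - x) \<partial>lborel) = 1"
  using lborel_integral_translate[of "\<lambda>y. gauss (y - x)" x]
  by (simp_all add: integral_gauss)

context
  fixes Q :: "'a::euclidean_space measure"
  assumes Q: "prob_space Q" and sQ [measurable_cong]: "sets Q = sets borel"
begin

interpretation Q: prob_space Q by (rule Q)
interpretation pair_sigma_finite Q lborel ..

lemma smoothed_density_nonneg: "smoothed_density Q y \<ge> 0"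
  unfolding smoothed_density_def by (intro Bochner_Integration.integral_nonneg) simp

text \<open>
  The integrand \<open>g y * gauss (y - x)\<close> is integrable on the product space because the Gaussian has
  mass one in \<open>y\<close> for every \<open>x\<close>, so integrating first over \<open>y\<close> bounds it by
  \<open>L\<close>.
\<close>

lemma smoothed_density_test:
  fixes g :: "'a \<Rightarrow> real"
  assumes g [measurable]: "g \<in> borel_measurable borel" and bd: "\<And>x. \<bar>g x\<bar> \<le> L"
  shows "integrable lborel (\<lambda>y. g y * smoothed_density Q y)"
    and "(\<integral>y. g y * smoothed_density Q y \<partial>lborel) = (\<integral>x. (\<integral>y. g y * gauss (y - x) \<partial>lborel) \<partial>Q)"
    and "integrable Q (\<lambda>x. \<integral>y. g y * gauss (y - x) \<partial>lborel)"
proof -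
  have g1: "integrable lborel (\<lambda>y. g y * gauss (y - x))" for x
  proof (rule Bochner_Integration.integrable_bound)
    show "integrable lborel (\<lambda>y. L * gauss (y - x))"
      using gauss_translate(1)[of x] by simp
    show "AE y in lborel. norm (g y * gauss (y - x)) \<le> norm (L * gauss (y - x))"
      by (auto simp: abs_mult intro!: mult_right_mono order_trans[OF bd])
  qed measurable
  have fin: "integrable (Q \<Otimes>\<^sub>M lborel) (\<lambda>(x, y). g y * gauss (y - x))"
  proof (rule Fubini_integrable)
    show "integrable Q (\<lambda>x. \<integral>y. norm (case (x, y) of (x, y) \<Rightarrow> g y * gauss (y - x)) \<partial>lborel)"
    proof (rule Q.integrable_const_bound[of _ L])
      show "AE x in Q. norm (\<integral>y. norm (case (x, y) of (x, y) \<Rightarrow> g y * gauss (y - x)) \<partial>lborel) \<le> L"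
      proof (intro AE_I2)
        fix x :: 'a
        have "(\<integral>y. \<bar>g y * gauss (y - x)\<bar> \<partial>lborel) \<le> (\<integral>y. L * gauss (y - x) \<partial>lborel)"
          using bd gauss_translate(1)[of x] g1[of x]
          by (intro integral_mono integrable_abs) (auto simp: abs_mult intro!: mult_right_mono)
        then show "norm (\<integral>y. norm (case (x, y) of (x, y) \<Rightarrow> g y * gauss (y - x)) \<partial>lborel) \<le> L"
          by (simp add: gauss_translate)
      qed
    qed measurable
  qed (use g1 in auto)
  show "integrable lborel (\<lambda>y. g y * smoothed_density Q y)"
    using integrable_snd[OF fin] by (simp add: smoothed_density_def)
  show "(\<integral>y. g y * smoothed_density Q y \<partial>lborel) = (\<integral>x. (\<integral>y. g y * gauss (y - x) \<partial>lborel) \<partial>Q)"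
    using Fubini_integral[OF fin] by (simp add: smoothed_density_def)
  show "integrable Q (\<lambda>x. \<integral>y. g y * gauss (y - x) \<partial>lborel)"
    using integrable_fst[OF fin] by simp
qed

lemma smoothed_density_integral:
  shows "integrable lborel (smoothed_density Q)" "(\<integral>y. smoothed_density Q y \<partial>lborel) = 1"
  using smoothed_density_test[of "\<lambda>_. 1" 1] by (simp_all add: gauss_translate Q.prob_space)

text \<open>
  Averaging \<open>g\<close> over a Gaussian displacement \<open>u\<close> changes its value by at most
  \<open>K * norm u\<close> on average.
\<close>

lemma smoothing_error:
  fixes g :: "'a \<Rightarrow> real"
  assumes g [measurable]: "g \<in> borel_measurable borel" and bd: "\<And>x. \<bar>g x\<bar> \<le> L"
    and lip: "\<And>x y. \<bar>g x - g y\<bar> \<le> K * norm (x - y)"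
  shows "\<bar>(\<integral>y. g y * smoothed_density Q y \<partial>lborel) - (\<integral>x. g x \<partial>Q)\<bar>
    \<le> K * (\<integral>u. norm (u::'a) * gauss u \<partial>lborel)"
proof -
  let ?m = "\<integral>u. norm (u::'a) * gauss u \<partial>lborel"
  have gQ: "integrable Q g"
    by (rule Q.integrable_const_bound[of _ L]) (use bd in auto)
  have pw: "\<bar>(\<integral>y. g y * gauss (y - x) \<partial>lborel) - g x\<bar> \<le> K * ?m" for x
  proof -
    have gi: "integrable lborel (\<lambda>u. g (x + u) * gauss u)"
    proof (rule Bochner_Integration.integrable_bound)
      show "integrable lborel (\<lambda>y::'a. L * gauss y)"
        by simp
      show "AE y in lborel. norm (g (x + y) * gauss y) \<le> norm (L * gauss y)"
        by (auto simp: abs_mult intro!: mult_right_mono order_trans[OF bd])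
    qed measurable
    have "(\<integral>y. g y * gauss (y - x) \<partial>lborel) - g x = (\<integral>u. g (x + u) * gauss u \<partial>lborel) - (\<integral>u. g x * gauss (u::'a) \<partial>lborel)"
      by (subst lborel_integral_translate(1)[of _ x]) (simp_all add: integral_gauss)
    also have "\<dots> = (\<integral>u. (g (x + u) - g x) * gauss u \<partial>lborel)"
      using gi by (simp add: left_diff_distrib)
    also have "\<bar>\<dots>\<bar> \<le> (\<integral>u. K * (norm (u::'a) * gauss u) \<partial>lborel)"
    proof (rule order_trans[OF integral_abs_bound], rule integral_mono)
      show "integrable lborel (\<lambda>u. \<bar>(g (x + u) - g x) * gauss (u::'a)\<bar>)"
        using gi by (simp add: left_diff_distrib)
      show "integrable lborel (\<lambda>u::'a. K * (norm u * gauss u))"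
        using integrable_norm_gauss[where 'a='a] by simp
      show "\<bar>(g (x + u) - g x) * gauss u\<bar> \<le> K * (norm u * gauss u)" for u :: 'a
        using lip[of "x + u" x] by (auto simp: abs_mult mult.assoc[symmetric] intro!: mult_right_mono)
    qed
    finally show ?thesis by simp
  qed
  have "(\<integral>y. g y * smoothed_density Q y \<partial>lborel) - (\<integral>x. g x \<partial>Q) =
      (\<integral>x. (\<integral>y. g y * gauss (y - x) \<partial>lborel) - g x \<partial>Q)"
    using smoothed_density_test[OF g bd] gQ by simp
  also have "\<bar>\<dots>\<bar> \<le> (\<integral>x. K * ?m \<partial>Q)"
    using smoothed_density_test(3)[OF g bd] gQ pw
    by (intro order_trans[OF integral_abs_bound integral_mono]) auto
  finally show ?thesis by (simp add: Q.prob_space)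
qed

text \<open>
  Fourier inversion without an inversion theorem: \<open>gauss (y - x)\<close> is \<open>gauss 0\<close> times the
  characteristic function of the Gaussian at \<open>x - y\<close>, and integrating over \<open>x\<close> under the
  Gaussian integral produces the characteristic function of \<open>Q\<close>.
\<close>

lemma smoothed_density_eq_char_fun:
  "complex_of_real (smoothed_density Q y) =
    gauss (0::'a) * (\<integral>t. exp (- (\<i> * complex_of_real (t \<bullet> y))) * char_fun Q t \<partial>gauss_measure)"
proof -
  interpret G: prob_space "gauss_measure :: 'a measure" by (rule prob_space_gauss_measure)
  interpret QG: pair_prob_space Q "gauss_measure :: 'a measure" ..
  have e: "complex_of_real (gauss (y - x)) =
      gauss (0::'a) * (\<integral>t. exp (\<i> * complex_of_real (t \<bullet> (x - y))) \<partial>gauss_measure)" for x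
    using char_fun_gauss[of "x - y"] unfolding char_fun_def
    by (subst gauss_eq) (simp add: inner_commute norm_minus_commute)
  have fin: "integrable (Q \<Otimes>\<^sub>M gauss_measure) (\<lambda>(x, t). exp (\<i> * complex_of_real (t \<bullet> (x - y))))"
    by (rule QG.integrable_const_bound[of _ 1]) (auto simp: split_beta)
  have "complex_of_real (smoothed_density Q y) = (\<integral>x. complex_of_real (gauss (y - x)) \<partial>Q)"
    unfolding smoothed_density_def by simp
  also have "\<dots> = gauss (0::'a) * (\<integral>x. \<integral>t. exp (\<i> * complex_of_real (t \<bullet> (x - y))) \<partial>gauss_measure \<partial>Q)"
    by (simp add: e)
  also have "(\<integral>x. \<integral>t. exp (\<i> * complex_of_real (t \<bullet> (x - y))) \<partial>gauss_measure \<partial>Q) =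
      (\<integral>t. \<integral>x. exp (\<i> * complex_of_real (t \<bullet> (x - y))) \<partial>Q \<partial>gauss_measure)"
    using QG.Fubini_integral[OF fin] by simp
  also have "\<dots> = (\<integral>t. exp (- (\<i> * complex_of_real (t \<bullet> y))) * char_fun Q t \<partial>gauss_measure)"
    unfolding char_fun_def
    by (subst integral_mult_right_zero[symmetric])
       (simp add: inner_diff_right exp_add[symmetric] algebra_simps)
  finally show ?thesis .
qed

end

lemma smoothed_density_diff_le:
  fixes P Q :: "'a::euclidean_space measure"
  assumes P: "prob_space P" "sets P = sets borel" and Q: "prob_space Q" "sets Q = sets borel"
  shows "\<bar>smoothed_density Q y - smoothed_density P y\<bar> \<le>
    gauss (0::'a) * (\<integral>t. norm (char_fun Q t - char_fun P t) \<partial>gauss_measure)"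
proof -
  interpret G: prob_space "gauss_measure :: 'a measure" by (rule prob_space_gauss_measure)
  note [measurable] = char_fun_measurable[OF P] char_fun_measurable[OF Q]
  have i: "integrable gauss_measure (\<lambda>t. exp (- (\<i> * complex_of_real (t \<bullet> y))) * char_fun R t)"
    if R: "prob_space R" "sets R = sets (borel :: 'a measure)" for R
  proof (rule G.integrable_const_bound[of _ 1])
    note [measurable] = char_fun_measurable[OF R]
    show "(\<lambda>t. exp (- (\<i> * complex_of_real (t \<bullet> y))) * char_fun R t) \<in> borel_measurable gauss_measure"
      by measurable
  qed (auto simp: norm_mult norm_char_fun_le[OF R(1)])
  have "complex_of_real (smoothed_density Q y - smoothed_density P y) =
    gauss (0::'a) * (\<integral>t. exp (- (\<i> * complex_of_real (t \<bullet> y))) * (char_fun Q t - char_fun P t) \<partial>gauss_measure)"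
    using i[OF P] i[OF Q]
    by (simp add: smoothed_density_eq_char_fun[OF P] smoothed_density_eq_char_fun[OF Q] right_diff_distrib)
  then have "norm (complex_of_real (smoothed_density Q y - smoothed_density P y)) =
    gauss (0::'a) * norm (\<integral>t. exp (- (\<i> * complex_of_real (t \<bullet> y))) * (char_fun Q t - char_fun P t) \<partial>gauss_measure)"
    by (simp only: norm_mult norm_of_real) simp
  also have "\<dots> \<le> gauss (0::'a) * (\<integral>t. norm (exp (- (\<i> * complex_of_real (t \<bullet> y))) * (char_fun Q t - char_fun P t)) \<partial>gauss_measure)"
    by (intro mult_left_mono integral_norm_bound) simp
  finally show ?thesis by (simp only: norm_of_real) (simp add: norm_mult)
qed

text \<open>
  Used for a smoothed density outside large balls and for the Gaussian measure of the points at which dividing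
  by a characteristic function would be costly.
\<close>

lemma tail_integral_small:
  fixes f :: "'b \<Rightarrow> real"
  assumes f: "integrable M f" and A: "\<And>n. A n \<in> sets M" "incseq A" "(\<Union>n. A n) = space M" and e: "e > 0"
  shows "\<exists>n::nat. (\<integral>x. f x * indicator (- A n) x \<partial>M) < e"
proof -
  have "(\<lambda>n. \<integral>x. f x * indicator (- A n) x \<partial>M) \<longlonglongrightarrow> (\<integral>x. 0 \<partial>M)"
  proof (rule integral_dominated_convergence)
    show "integrable M (\<lambda>x. norm (f x))" using f by simp
    show "(\<lambda>x. f x * indicator (- A n) x) \<in> borel_measurable M" for n
    proof -
      have "(\<lambda>x. f x * indicator (space M - A n) x) \<in> borel_measurable M"
        using f A(1) by (intro borel_measurable_times borel_measurable_integrable borel_measurable_indicator) auto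
      then show ?thesis
        by (rule measurable_cong[THEN iffD1, rotated]) (auto simp: indicator_def)
    qed
    show "AE x in M. (\<lambda>n. f x * indicator (- A n) x) \<longlonglongrightarrow> 0"
    proof (rule AE_I2)
      fix x assume "x \<in> space M"
      then obtain m where m: "x \<in> A m" using A(3) by auto
      have "eventually (\<lambda>n. f x * indicator (- A n) x = 0) sequentially"
        using eventually_ge_at_top[of m]
      proof eventually_elim
        case (elim n) then show ?case using incseqD[OF A(2), of m n] m by (auto simp: indicator_def)
      qed
      then show "(\<lambda>n. f x * indicator (- A n) x) \<longlonglongrightarrow> 0"
        by (rule tendsto_eventually)
    qed
  qed (auto simp: indicator_def)
  then have "eventually (\<lambda>n. (\<integral>x. f x * indicator (- A n) x \<partial>M) < e) sequentially"
    using e by (intro order_tendstoD) auto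
  then show ?thesis by (auto simp: eventually_sequentially)
qed

text \<open>
  As \<open>p\<close> and \<open>q\<close> have the same integral, the mean of \<open>\<bar>q - p\<bar>\<close> is twice that of the
  positive part of \<open>p - q\<close>, which is at most \<open>D\<close> on \<open>B\<close> and at most \<open>p\<close>
  elsewhere. Only the tail of \<open>p\<close> enters, which makes the bound uniform in \<open>q\<close>.
\<close>

lemma scheffe_bound:
  fixes p q :: "'b \<Rightarrow> real"
  assumes p: "integrable M p" "\<And>x. p x \<ge> 0" and q: "integrable M q" "\<And>x. q x \<ge> 0"
    and eq: "(\<integral>x. q x \<partial>M) = (\<integral>x. p x \<partial>M)"
    and D: "\<And>x. \<bar>q x - p x\<bar> \<le> D" and B: "B \<in> sets M" "emeasure M B < \<infinity>" and U: "space M = UNIV"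
  shows "(\<integral>x. \<bar>q x - p x\<bar> \<partial>M) \<le> 2 * (D * measure M B + (\<integral>x. p x * indicator (- B) x \<partial>M))"
proof -
  have B': "- B \<in> sets M" using sets.compl_sets[OF B(1)] U by (simp add: Compl_eq_Diff_UNIV)
  have i1: "integrable M (\<lambda>x. D * indicator B x)" using B by simp
  have i2: "integrable M (\<lambda>x. p x * indicator (- B) x)"
    using integrable_mult_indicator[OF B' p(1)] by (simp add: mult.commute)
  have "(\<integral>x. \<bar>q x - p x\<bar> \<partial>M) \<le> (\<integral>x. (q x - p x) + 2 * (D * indicator B x + p x * indicator (- B) x) \<partial>M)"
  proof (rule integral_mono)
    show "\<bar>q x - p x\<bar> \<le> (q x - p x) + 2 * (D * indicator B x + p x * indicator (- B) x)" for x
      using D[of x] p(2)[of x] q(2)[of x] by (auto simp: indicator_def)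
  qed (use p q i1 i2 in auto)
  also have "\<dots> = 2 * (D * measure M B + (\<integral>x. p x * indicator (- B) x \<partial>M))"
    using p q i1 i2 B eq by simp
  finally show ?thesis .
qed

lemma char_fun_distr_scaleR:
  fixes Q :: "'a::euclidean_space measure"
  assumes [measurable_cong]: "sets Q = sets borel"
  shows "char_fun (distr Q borel (\<lambda>x. s *\<^sub>R x)) t = char_fun Q (s *\<^sub>R t)"
  unfolding char_fun_def by (subst integral_distr) auto

text \<open>
  A quantitative and uniform form of the continuity theorem for characteristic functions. Closeness is asked in
  Gaussian mean rather than at finitely many points: finitely many values of a characteristic function cannot detect mass
  far away, since finitely many characters are simultaneously almost one at suitable far points. The scale \<open>s\<close>
  and the tolerance \<open>\<kappa>\<close> depend on \<open>P\<close>, \<open>L\<close>, \<open>K\<close> and \<open>\<eta>\<close> but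
  not on \<open>Q\<close> or \<open>g\<close>. Dilating the laws by \<open>s\<close> divides the Lipschitz constant by
  \<open>s\<close>, so that one fixed Gaussian serves for every degree of smoothing.
\<close>

lemma char_fun_gap_controls_lipschitz_gap:
  fixes P :: "'a::euclidean_space measure"
  assumes P: "prob_space P" "sets P = sets borel" and pos: "\<eta> > 0" "L \<ge> 0" "K \<ge> 0"
  shows "\<exists>s>0. \<exists>\<kappa>>0. \<forall>Q g. prob_space Q \<longrightarrow> sets Q = sets borel \<longrightarrow>
      (\<integral>t. norm (char_fun Q (s *\<^sub>R t) - char_fun P (s *\<^sub>R t)) \<partial>(gauss_measure :: 'a measure)) \<le> \<kappa> \<longrightarrow>
      (\<forall>x. \<bar>g x\<bar> \<le> L) \<longrightarrow> (\<forall>x y. \<bar>g x - g y\<bar> \<le> K * norm (x - y)) \<longrightarrow>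
      \<bar>(\<integral>x. g x \<partial>Q) - (\<integral>x. g x \<partial>P)\<bar> \<le> \<eta>"
proof -
  define m where "m = (\<integral>u. norm (u::'a) * gauss u \<partial>lborel)"
  have m0: "m \<ge> 0" unfolding m_def by (intro Bochner_Integration.integral_nonneg) simp
  \<comment> \<open>smoothing is applied to both laws; with this dilation the two errors sum to at most \<open>\<eta> / 2\<close>\<close>
  define s where "s = 4 * (K * m + 1) / \<eta>"
  have s0: "s > 0" unfolding s_def using pos m0 by (intro divide_pos_pos) (auto intro: add_nonneg_pos)
  have sK: "2 * (K / s * m) \<le> \<eta> / 2"
  proof -
    have "4 * (K * m) \<le> \<eta> * s" unfolding s_def using pos by simp
    then show ?thesis using s0 by (simp add: field_simps)
  qed
  define Ps where "Ps = distr P borel (\<lambda>x. s *\<^sub>R x)"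
  have mP: "(\<lambda>x. s *\<^sub>R x) \<in> P \<rightarrow>\<^sub>M borel" using P(2) by (simp cong: measurable_cong_sets)
  have Ps: "prob_space Ps" "sets Ps = sets borel"
    unfolding Ps_def using prob_space.prob_space_distr[OF P(1) mP] by auto
  let ?p = "smoothed_density Ps"
  obtain n :: nat where n: "(\<integral>x. ?p x * indicator (- cball 0 (real n)) x \<partial>lborel) < \<eta> / (8 * (L + 1))"
  proof -
    have "\<exists>n::nat. (\<integral>x. ?p x * indicator (- cball 0 (real n)) x \<partial>lborel) < \<eta> / (8 * (L + 1))"
    proof (rule tail_integral_small)
      show "integrable lborel ?p" by (rule smoothed_density_integral[OF Ps])
      show "incseq (\<lambda>n. cball (0::'a) (real n))" by (auto simp: incseq_def)
      show "(\<Union>n. cball (0::'a) (real n)) = space lborel" by (auto simp: real_arch_simple)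
    qed (use pos in auto)
    then show ?thesis using that by blast
  qed
  define V where "V = measure lborel (cball (0::'a) (real n))"
  have V0: "V \<ge> 0" by (simp add: V_def)
  have g0: "gauss (0::'a) \<ge> 0" by simp
  \<comment> \<open>chosen so that the ball contributes no more than the bound just obtained for the tail of \<open>?p\<close>;
    the summands 1 keep the denominators positive\<close>
  define W where "W = 8 * (L + 1) * (gauss (0::'a) * V + 1)"
  have W0: "W > 0" unfolding W_def using pos g0 V0 by (intro mult_pos_pos add_nonneg_pos) auto
  define \<kappa> where "\<kappa> = \<eta> / W"
  have k0: "\<kappa> > 0" unfolding \<kappa>_def using pos W0 by simp
  show ?thesis
  proof (intro exI conjI allI impI)
    show "s > 0" "\<kappa> > 0" by fact+
    fix Q :: "'a measure" and g :: "'a \<Rightarrow> real"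
    assume Q: "prob_space Q" "sets Q = sets borel"
      and D: "(\<integral>t. norm (char_fun Q (s *\<^sub>R t) - char_fun P (s *\<^sub>R t)) \<partial>gauss_measure) \<le> \<kappa>"
      and bd: "\<forall>x. \<bar>g x\<bar> \<le> L" and lip: "\<forall>x y. \<bar>g x - g y\<bar> \<le> K * norm (x - y)"
    define Qs where "Qs = distr Q borel (\<lambda>x. s *\<^sub>R x)"
    have mQ: "(\<lambda>x. s *\<^sub>R x) \<in> Q \<rightarrow>\<^sub>M borel" using Q(2) by (simp cong: measurable_cong_sets)
    have Qs: "prob_space Qs" "sets Qs = sets borel"
      unfolding Qs_def using prob_space.prob_space_distr[OF Q(1) mQ] by auto
    let ?q = "smoothed_density Qs"
    define h where "h = (\<lambda>x. g (x /\<^sub>R s))"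
    have hb: "\<bar>h x\<bar> \<le> L" for x using bd by (simp add: h_def)
    have hl: "\<bar>h x - h y\<bar> \<le> K / s * norm (x - y)" for x y
    proof -
      have "\<bar>h x - h y\<bar> \<le> K * norm (x /\<^sub>R s - y /\<^sub>R s)" unfolding h_def using lip by blast
      also have "norm (x /\<^sub>R s - y /\<^sub>R s) = norm (x - y) / s"
        using s0 by (simp add: scaleR_diff_right[symmetric] divide_inverse_commute)
      finally show ?thesis by simp
    qed
    have hm [measurable]: "h \<in> borel_measurable borel"
    proof (rule borel_measurable_continuous_onI)
      have "(K / s)-lipschitz_on UNIV h"
        using hl pos s0 by (intro lipschitz_onI) (auto simp: dist_norm dist_real_def)
      then show "continuous_on UNIV h" by (rule lipschitz_on_continuous_on)
    qed
    have hQ: "(\<integral>x. g x \<partial>Q) = (\<integral>x. h x \<partial>Qs)" "(\<integral>x. g x \<partial>P) = (\<integral>x. h x \<partial>Ps)"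
    proof -
      have "h (s *\<^sub>R x) = g x" for x using s0 by (simp add: h_def)
      then show "(\<integral>x. g x \<partial>Q) = (\<integral>x. h x \<partial>Qs)" "(\<integral>x. g x \<partial>P) = (\<integral>x. h x \<partial>Ps)"
        by (simp_all add: Qs_def Ps_def integral_distr[OF mQ hm] integral_distr[OF mP hm])
    qed
    note pi = smoothed_density_integral[OF Ps] and qi = smoothed_density_integral[OF Qs]
    define D' where "D' = gauss (0::'a) * \<kappa>"
    have D': "\<bar>?q y - ?p y\<bar> \<le> D'" for y
      using smoothed_density_diff_le[OF Ps Qs, of y] mult_left_mono[OF D g0]
      by (simp add: D'_def Qs_def Ps_def char_fun_distr_scaleR[OF P(2)] char_fun_distr_scaleR[OF Q(2)])
    have "(\<integral>y. \<bar>?q y - ?p y\<bar> \<partial>lborel) \<le>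
        2 * (D' * measure lborel (cball (0::'a) (real n)) + (\<integral>x. ?p x * indicator (- cball 0 (real n)) x \<partial>lborel))"
      using D' pi qi smoothed_density_nonneg[OF Ps] smoothed_density_nonneg[OF Qs]
      by (intro scheffe_bound) (auto simp: emeasure_lborel_cball_finite[simplified])
    also have "\<dots> \<le> 2 * (\<eta> / (8 * (L + 1)) + \<eta> / (8 * (L + 1)))"
    proof -
      have "D' * V \<le> \<eta> / (8 * (L + 1))"
      proof -
        have "D' * V = \<kappa> * (gauss (0::'a) * V)" by (simp add: D'_def)
        also have "\<dots> \<le> \<kappa> * (gauss (0::'a) * V + 1)" using k0 by simp
        also have "\<dots> = \<eta> / (8 * (L + 1))"
        proof -
          have "gauss (0::'a) * V + 1 > 0" using g0 V0 by (intro add_nonneg_pos) auto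
          then show ?thesis unfolding \<kappa>_def W_def by simp
        qed
        finally show ?thesis .
      qed
      then show ?thesis using n by (simp add: V_def)
    qed
    also have "\<dots> = \<eta> / (2 * (L + 1))" using pos by (simp add: divide_simps)
    finally have S: "(\<integral>y. \<bar>?q y - ?p y\<bar> \<partial>lborel) \<le> \<eta> / (2 * (L + 1))" .
    have "\<bar>(\<integral>y. h y * ?q y \<partial>lborel) - (\<integral>y. h y * ?p y \<partial>lborel)\<bar> = \<bar>\<integral>y. h y * (?q y - ?p y) \<partial>lborel\<bar>"
      using smoothed_density_test(1)[OF Ps hm hb] smoothed_density_test(1)[OF Qs hm hb]
      by (simp add: right_diff_distrib)
    also have "\<dots> \<le> (\<integral>y. L * \<bar>?q y - ?p y\<bar> \<partial>lborel)"
    proof (rule order_trans[OF integral_abs_bound], rule integral_mono)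
      show "integrable lborel (\<lambda>y. \<bar>h y * (?q y - ?p y)\<bar>)"
        using smoothed_density_test(1)[OF Ps hm hb] smoothed_density_test(1)[OF Qs hm hb]
        by (simp add: right_diff_distrib)
    qed (use pi qi hb in \<open>auto simp: abs_mult intro!: mult_right_mono\<close>)
    also have "\<dots> = L * (\<integral>y. \<bar>?q y - ?p y\<bar> \<partial>lborel)" by simp
    also have "\<dots> \<le> L * (\<eta> / (2 * (L + 1)))" using S pos by (intro mult_left_mono) auto
    also have "\<dots> \<le> \<eta> / 2" using pos by (simp add: field_simps)
    finally have "\<bar>(\<integral>y. h y * ?q y \<partial>lborel) - (\<integral>y. h y * ?p y \<partial>lborel)\<bar> \<le> \<eta> / 2" .
    moreover note smoothing_error[OF Ps hm hb hl] smoothing_error[OF Qs hm hb hl] sK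
    ultimately show "\<bar>(\<integral>x. g x \<partial>Q) - (\<integral>x. g x \<partial>P)\<bar> \<le> \<eta>"
      unfolding hQ m_def by linarith
  qed
qed

section \<open>Bounds on the Kullback-Leibler divergence\<close>

lemma mult_ln_ge: "y * ln y \<ge> y - 1" if "y \<ge> 0" for y :: real
proof (cases "y = 0")
  case False
  then have "ln (1 / y) \<le> 1 / y - 1" using that by (intro ln_le_minus_one) simp
  then have "y * (- ln y) \<le> y * (1 / y - 1)"
    using that False by (intro mult_left_mono) (auto simp: ln_div)
  then show ?thesis using False by (simp add: algebra_simps)
qed simp

lemma mult_ln_le: "y * ln y \<le> y\<^sup>2 - y" if "y \<ge> 0" for y :: real
proof (cases "y = 0")
  case False
  then have "y * ln y \<le> y * (y - 1)" using that by (intro mult_left_mono ln_le_minus_one) auto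
  then show ?thesis by (simp add: power2_eq_square algebra_simps)
qed simp

text \<open>
  The left side is the integrand of the squared Hellinger distance. Multiplying \<open>ln x \<ge> 1 - 1 / x\<close> at
  \<open>x = sqrt y\<close> by \<open>2 * y\<close> gives the inequality.
\<close>

lemma hellinger_le_mult_ln: "(sqrt y - 1)\<^sup>2 \<le> y * ln y - y + 1" if "y \<ge> 0" for y :: real
proof -
  have "sqrt y * ln (sqrt y) \<ge> sqrt y - 1" by (rule mult_ln_ge) (use that in simp)
  then have "2 * sqrt y * (sqrt y * ln (sqrt y)) \<ge> 2 * sqrt y * (sqrt y - 1)"
    using that by (intro mult_left_mono) auto
  moreover have "2 * sqrt y * (sqrt y * ln (sqrt y)) = y * ln y"
    using that by (cases "y = 0") (auto simp: ln_sqrt)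
  moreover have "sqrt y * sqrt y = y" using that by simp
  ultimately show ?thesis unfolding power2_eq_square by (simp only: algebra_simps)
qed

text \<open>
  Factor \<open>\<bar>y - 1\<bar>\<close> as \<open>\<bar>sqrt y - 1\<bar> * (sqrt y + 1)\<close> and apply the weighted
  arithmetic-geometric inequality; the weight \<open>\<theta>\<close> replaces the Cauchy-Schwarz inequality after
  integration.
\<close>

lemma abs_diff_one_le_entropy:
  fixes y \<theta> :: real
  assumes y: "y \<ge> 0" and \<theta>: "\<theta> > 0"
  shows "\<bar>y - 1\<bar> \<le> (y * ln y - y + 1) / (2 * \<theta>) + \<theta> * (y + 1)"
proof -
  define s where "s = sqrt y"
  have s: "y = s\<^sup>2" "s \<ge> 0" using y by (auto simp: s_def)
  have 1: "\<bar>y - 1\<bar> = \<bar>s - 1\<bar> * (s + 1)"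
  proof -
    have "y - 1 = (s - 1) * (s + 1)" by (simp add: s power2_eq_square algebra_simps)
    then show ?thesis using s by (simp add: abs_mult)
  qed
  have "0 \<le> (\<bar>s - 1\<bar> - \<theta> * (s + 1))\<^sup>2" by simp
  also have "\<dots> = (s - 1)\<^sup>2 + \<theta>\<^sup>2 * (s + 1)\<^sup>2 - 2 * \<theta> * (\<bar>s - 1\<bar> * (s + 1))"
    by (subst power2_diff) (simp add: power_mult_distrib)
  finally have "2 * \<theta> * (\<bar>s - 1\<bar> * (s + 1)) \<le> (s - 1)\<^sup>2 + \<theta>\<^sup>2 * (s + 1)\<^sup>2"
    by simp
  also have "\<theta>\<^sup>2 * (s + 1)\<^sup>2 \<le> \<theta>\<^sup>2 * (2 * (y + 1))"
  proof (intro mult_left_mono)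
    have "0 \<le> (s - 1)\<^sup>2" by simp
    then show "(s + 1)\<^sup>2 \<le> 2 * (y + 1)" by (simp add: s power2_eq_square algebra_simps)
  qed simp
  also have "(s - 1)\<^sup>2 \<le> y * ln y - y + 1" unfolding s_def by (rule hellinger_le_mult_ln[OF y])
  finally have "2 * \<theta> * \<bar>y - 1\<bar> \<le> (y * ln y - y + 1) + \<theta>\<^sup>2 * (2 * (y + 1))"
    by (simp add: 1)
  then show ?thesis using \<theta> by (simp add: field_simps power2_eq_square)
qed

text \<open>
  From \<open>ln y \<le> y - 1\<close>. Boundedness of the density makes the divergence finite.
\<close>

lemma KL_density_le_chi_square:
  fixes f :: "'b \<Rightarrow> real"
  assumes "prob_space \<nu>" and f [measurable]: "f \<in> borel_measurable \<nu>"
    and f0: "\<And>x. f x \<ge> 0" and fB: "\<And>x. f x \<le> B" and f1: "(\<integral>x. f x \<partial>\<nu>) = 1"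
  shows "KL (density \<nu> f) \<nu> \<le> ereal ((\<integral>x. (f x)\<^sup>2 \<partial>\<nu>) - 1)"
proof -
  interpret prob_space \<nu> by fact
  have B0: "B \<ge> 0" using f0 fB order_trans by blast
  have AE: "AE x in \<nu>. ennreal (f x) = RN_deriv \<nu> (density \<nu> f) x"
    by (rule RN_deriv_unique) auto
  have e: "AE x in \<nu>. f x *\<^sub>R entropy_density (exp 1) \<nu> (density \<nu> f) x = f x * ln (f x)"
    using AE
  proof eventually_elim
    case (elim x)
    then show ?case by (simp add: entropy_density_def elim[symmetric] f0 log_ln)
  qed
  have fi: "integrable \<nu> f" and f2i: "integrable \<nu> (\<lambda>x. (f x)\<^sup>2)"
    using f0 fB power_mono[OF fB f0, of _ 2]
    by (auto intro!: integrable_const_bound[where B=B and f=f]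
          integrable_const_bound[where B="B\<^sup>2" and f="\<lambda>x. (f x)\<^sup>2"])
  have fl: "integrable \<nu> (\<lambda>x. f x * ln (f x))"
  proof (rule integrable_const_bound[of _ "1 + B\<^sup>2"])
    show "AE x in \<nu>. norm (f x * ln (f x)) \<le> 1 + B\<^sup>2"
    proof (rule AE_I2)
      fix x
      have "(f x)\<^sup>2 \<le> B\<^sup>2" using f0 fB by (intro power_mono)
      moreover have "0 \<le> B\<^sup>2" by simp
      ultimately have "\<bar>f x * ln (f x)\<bar> \<le> 1 + B\<^sup>2"
        using mult_ln_ge[OF f0, of x] mult_ln_le[OF f0, of x] f0[of x] by linarith
      then show "norm (f x * ln (f x)) \<le> 1 + B\<^sup>2" by simp
    qed
  qed measurable
  have "integrable (density \<nu> f) (entropy_density (exp 1) \<nu> (density \<nu> f))"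
    using fl f0 by (subst integrable_density) (auto simp del: real_scaleR_def simp: integrable_cong_AE[OF _ _ e])
  moreover have "absolutely_continuous \<nu> (density \<nu> f)"
    by (rule absolutely_continuousI_density) simp
  moreover have "KL_divergence (exp 1) \<nu> (density \<nu> f) \<le> (\<integral>x. (f x)\<^sup>2 \<partial>\<nu>) - 1"
  proof -
    have "KL_divergence (exp 1) \<nu> (density \<nu> f) = (\<integral>x. f x * ln (f x) \<partial>\<nu>)"
      using f0 by (subst KL_density) (auto simp: log_ln)
    also have "\<dots> \<le> (\<integral>x. (f x)\<^sup>2 - f x \<partial>\<nu>)"
      using fl fi f2i mult_ln_le[OF f0] by (intro integral_mono) auto
    finally show ?thesis using fi f2i f1 by simp
  qed
  ultimately show ?thesis by (simp add: KL_def)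
qed

text \<open>
  Pinsker's inequality with a worse constant, which is harmless here: the relative density \<open>D\<close> of
  \<open>\<upsilon>\<close> with respect to \<open>\<nu>\<close> has mean one, so the mean of \<open>D * ln D - D + 1\<close>
  is the divergence, and \<open>abs_diff_one_le_entropy\<close> turns it into a bound on the mean of
  \<open>\<bar>D - 1\<bar>\<close>.
\<close>

lemma KL_controls_total_variation:
  assumes \<nu>: "prob_space \<nu>" and \<upsilon>: "prob_space \<upsilon>" and sets: "sets \<upsilon> = sets \<nu>"
    and KL: "KL \<upsilon> \<nu> < ereal \<rho>" and \<rho>: "\<rho> > 0"
    and \<phi>: "\<phi> \<in> borel_measurable \<nu>" "\<And>x. \<bar>\<phi> x\<bar> \<le> (1::real)"
  shows "\<bar>(\<integral>x. \<phi> x \<partial>\<upsilon>) - (\<integral>x. \<phi> x \<partial>\<nu>)\<bar> \<le> 3 * sqrt \<rho>"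
proof -
  interpret N: prob_space \<nu> by fact
  interpret U: prob_space \<upsilon> by fact
  have ac: "absolutely_continuous \<nu> \<upsilon>" and int: "integrable \<upsilon> (entropy_density (exp 1) \<nu> \<upsilon>)"
    and kl: "KL_divergence (exp 1) \<nu> \<upsilon> < \<rho>"
    using KL by (auto simp: KL_def split: if_splits)
  obtain D where D [measurable]: "D \<in> borel_measurable \<nu>"
    and AE: "AE x in \<nu>. RN_deriv \<nu> \<upsilon> x = ennreal (D x)" and D0: "\<And>x. 0 \<le> D x"
    using N.real_RN_deriv[OF U.finite_measure_axioms ac sets] by metis
  have U: "\<upsilon> = density \<nu> D"
    using N.density_RN_deriv[OF ac sets] density_cong[OF _ _ AE] by simp
  have e: "AE x in \<nu>. D x *\<^sub>R entropy_density (exp 1) \<nu> \<upsilon> x = D x * ln (D x)"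
    using AE by eventually_elim (simp add: entropy_density_def D0 log_ln)
  have Dl: "integrable \<nu> (\<lambda>x. D x * ln (D x))"
  proof -
    have "integrable \<nu> (\<lambda>x. D x *\<^sub>R entropy_density (exp 1) \<nu> \<upsilon> x)"
      using int D0 by (subst (asm) (1) U, subst (asm) integrable_density) auto
    then show ?thesis
      using e by (subst (asm) integrable_cong_AE) auto
  qed
  have Di: "integrable \<nu> D" and D1: "(\<integral>x. D x \<partial>\<nu>) = 1"
  proof -
    have "(\<integral>\<^sup>+x. ennreal (D x) \<partial>\<nu>) = 1"
      using U.emeasure_space_1 by (simp add: U emeasure_density cong: nn_integral_cong)
    then show "integrable \<nu> D" "(\<integral>x. D x \<partial>\<nu>) = 1"
      using D0 by (auto simp: integrable_iff_bounded integral_eq_nn_integral)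
  qed
  have kl': "(\<integral>x. D x * ln (D x) \<partial>\<nu>) < \<rho>"
    using kl D0 unfolding U by (subst (asm) N.KL_density) (auto simp: log_ln)
  have \<phi>D: "integrable \<nu> (\<lambda>x. D x * \<phi> x)"
    using \<phi> D0 by (intro Bochner_Integration.integrable_bound[OF Di])
       (auto simp: abs_mult intro!: mult_left_le)
  have \<phi>i: "integrable \<nu> \<phi>"
    using \<phi> by (intro N.integrable_const_bound[of _ 1]) auto
  \<comment> \<open>balances the two terms of the entropy bound\<close>
  define \<theta> where "\<theta> = sqrt \<rho>"
  have \<theta>: "\<theta> > 0" "\<theta> * \<theta> = \<rho>" using \<rho> by (auto simp: \<theta>_def)
  have "(\<integral>x. \<phi> x \<partial>\<upsilon>) - (\<integral>x. \<phi> x \<partial>\<nu>) = (\<integral>x. D x * \<phi> x - \<phi> x \<partial>\<nu>)"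
    using D0 \<phi> \<phi>D \<phi>i unfolding U by (subst integral_density) auto
  also have "\<bar>\<dots>\<bar> \<le> (\<integral>x. (D x * ln (D x) - D x + 1) / (2 * \<theta>) + \<theta> * (D x + 1) \<partial>\<nu>)"
  proof (rule order_trans[OF integral_abs_bound], rule integral_mono)
    show "\<bar>D x * \<phi> x - \<phi> x\<bar> \<le> (D x * ln (D x) - D x + 1) / (2 * \<theta>) + \<theta> * (D x + 1)" for x
    proof -
      have "\<bar>D x * \<phi> x - \<phi> x\<bar> = \<bar>D x - 1\<bar> * \<bar>\<phi> x\<bar>"
        by (simp add: abs_mult[symmetric] left_diff_distrib)
      also have "\<dots> \<le> \<bar>D x - 1\<bar>" using \<phi> by (intro mult_left_le) auto
      finally show ?thesis using abs_diff_one_le_entropy[OF D0 \<theta>(1), of x] by linarith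
    qed
  qed (use Dl Di \<phi>D \<phi>i in auto)
  also have "\<dots> = (\<integral>x. D x * ln (D x) \<partial>\<nu>) / (2 * \<theta>) + 2 * \<theta>"
    using Dl Di D1 by (simp add: N.prob_space)
  also have "\<dots> \<le> \<rho> / (2 * \<theta>) + 2 * \<theta>"
    using kl' \<theta> by (intro add_right_mono divide_right_mono) auto
  also have "\<dots> \<le> 3 * \<theta>" using \<theta> \<rho> by (simp add: \<theta>(2)[symmetric])
  finally show ?thesis by (simp add: \<theta>_def)
qed

section \<open>Norms and the Levy-Prokhorov metric\<close>

context
  fixes nrm :: "'a::euclidean_space \<Rightarrow> real"
  assumes nrm: "is_norm nrm"
begin

lemma is_norm_rules: "nrm 0 = 0" "nrm (- x) = nrm x" "nrm (x - y) = nrm (y - x)" "0 \<le> nrm x"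
  "nrm (x + y) \<le> nrm x + nrm y" "nrm (c *\<^sub>R x) = \<bar>c\<bar> * nrm x"
proof -
  have tri: "nrm (a + b) \<le> nrm a + nrm b" for a b using nrm by (simp add: is_norm_def)
  have sc: "nrm (a *\<^sub>R b) = \<bar>a\<bar> * nrm b" for a b using nrm by (simp add: is_norm_def)
  show z: "nrm 0 = 0" using nrm by (simp add: is_norm_def)
  have m: "nrm (- a) = nrm a" for a using sc[of "-1" a] by simp
  then show "nrm (- x) = nrm x" .
  show "nrm (x - y) = nrm (y - x)" using m[of "x - y"] by simp
  show "0 \<le> nrm x" using tri[of x "- x"] z m[of x] by simp
  show "nrm (x + y) \<le> nrm x + nrm y" "nrm (c *\<^sub>R x) = \<bar>c\<bar> * nrm x" by (rule tri sc)+
qed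

lemma nrm_le_norm: "\<exists>C>0. \<forall>x. nrm x \<le> C * norm x"
proof -
  define C where "C = 1 + (\<Sum>b\<in>Basis. nrm b)"
  have "nrm x \<le> C * norm x" for x
  proof -
    have sum: "nrm (\<Sum>b\<in>B. (x \<bullet> b) *\<^sub>R b) \<le> (\<Sum>b\<in>B. nrm ((x \<bullet> b) *\<^sub>R b))" if "finite B" for B
      using that
    proof induction
      case (insert b B)
      then show ?case
        using is_norm_rules(5)[of "(x \<bullet> b) *\<^sub>R b" "\<Sum>b\<in>B. (x \<bullet> b) *\<^sub>R b"] by simp
    qed (simp add: is_norm_rules)
    have "nrm x = nrm (\<Sum>b\<in>Basis. (x \<bullet> b) *\<^sub>R b)" by (simp add: euclidean_representation)
    also have "\<dots> \<le> (\<Sum>b\<in>Basis. nrm ((x \<bullet> b) *\<^sub>R b))" by (rule sum) simp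
    also have "\<dots> \<le> (\<Sum>b\<in>Basis. norm x * nrm b)"
      by (intro sum_mono) (auto simp: is_norm_rules intro!: mult_right_mono Basis_le_norm)
    also have "\<dots> \<le> C * norm x" by (simp add: C_def sum_distrib_left algebra_simps)
    finally show ?thesis .
  qed
  moreover have "C > 0" unfolding C_def by (intro add_pos_nonneg sum_nonneg) (auto simp: is_norm_rules)
  ultimately show ?thesis by blast
qed

lemma nrm_diff_ge: "\<bar>nrm x - nrm y\<bar> \<le> nrm (x - y)"
  using is_norm_rules(5)[of "x - y" y] is_norm_rules(5)[of "y - x" x] is_norm_rules(3)[of x y] by simp

lemma continuous_nrm: "continuous_on UNIV nrm"
proof -
  obtain C where C: "C > 0" "\<And>x. nrm x \<le> C * norm x" using nrm_le_norm by blast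
  have "C-lipschitz_on UNIV nrm"
    using C nrm_diff_ge by (intro lipschitz_onI) (auto simp: dist_norm dist_real_def intro: order_trans)
  then show ?thesis by (rule lipschitz_on_continuous_on)
qed

text \<open>
  The continuous function \<open>nrm\<close> attains a positive minimum on the compact unit sphere.
\<close>

lemma norm_le_nrm: "\<exists>c>0. \<forall>x. c * norm x \<le> nrm x"
proof -
  obtain b :: 'a where b: "b \<in> Basis" using nonempty_Basis by blast
  have "compact (sphere (0::'a) 1)" by simp
  moreover have "sphere (0::'a) 1 \<noteq> {}" using b by auto
  moreover have "continuous_on (sphere (0::'a) 1) nrm"
    using continuous_nrm continuous_on_subset by blast
  ultimately obtain u where u: "u \<in> sphere 0 1" "\<And>y. y \<in> sphere 0 1 \<Longrightarrow> nrm u \<le> nrm y"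
    using continuous_attains_inf[of "sphere 0 1" nrm] by blast
  have "nrm u \<noteq> 0" using u(1) nrm by (auto simp: is_norm_def)
  then have "nrm u > 0" using is_norm_rules(4)[of u] by simp
  moreover have "nrm u * norm x \<le> nrm x" for x
  proof (cases "x = 0")
    case False
    then have "nrm u \<le> nrm (x /\<^sub>R norm x)" by (intro u) simp
    also have "\<dots> = nrm x / norm x" by (simp add: is_norm_rules divide_inverse_commute)
    finally show ?thesis using False by (simp add: field_simps)
  qed (simp add: is_norm_rules)
  ultimately show ?thesis by blast
qed

lemma open_enlargement: "open {x. \<exists>a\<in>A. nrm (x - a) < e}"
proof -
  have "open {x. nrm (x - a) < e}" for a
    by (intro open_Collect_less continuous_intros continuous_on_compose2[OF continuous_nrm]) auto
  then have "open (\<Union>a\<in>A. {x. nrm (x - a) < e})" by blast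
  also have "(\<Union>a\<in>A. {x. nrm (x - a) < e}) = {x. \<exists>a\<in>A. nrm (x - a) < e}" by auto
  finally show ?thesis .
qed

text \<open>
  Two laws that give the same mass to every cell differ only by moving mass inside cells. In a cell of small
  diameter the mass stays within the enlargement of any set that meets the cell; the mass of the cell \<open>out\<close>,
  whose diameter is not controlled, is absorbed by the additive tolerance.
\<close>

lemma LP_le_of_equal_cells:
  fixes q :: "'a \<Rightarrow> 'i"
  assumes \<mu>: "prob_space \<mu>" "sets \<mu> = sets borel" and \<nu>: "prob_space \<nu>" "sets \<nu> = sets borel"
    and J: "finite J" "\<And>x. q x \<in> J" "\<And>j. j \<in> J \<Longrightarrow> q -` {j} \<in> sets borel"
    and eq: "\<And>j. j \<in> J \<Longrightarrow> measure \<mu> (q -` {j}) = measure \<nu> (q -` {j})"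
    and out: "out \<in> J" "measure \<nu> (q -` {out}) \<le> \<delta>" and \<delta>: "\<delta> > 0"
    and diam: "\<And>x y. q x = q y \<Longrightarrow> q x \<noteq> out \<Longrightarrow> nrm (x - y) < \<delta>"
  shows "LP nrm \<mu> \<nu> \<le> \<delta>"
proof -
  have one: "measure \<mu> A \<le> measure \<nu> {x. \<exists>a\<in>A. nrm (x - a) < \<delta>} + \<delta>"
    if \<mu>: "prob_space \<mu>" "sets \<mu> = sets borel" and \<nu>: "prob_space \<nu>" "sets \<nu> = sets borel"
      and eq: "\<And>j. j \<in> J \<Longrightarrow> measure \<mu> (q -` {j}) = measure \<nu> (q -` {j})"
      and o: "measure \<mu> (q -` {out}) \<le> \<delta>" for \<mu> \<nu> :: "'a measure" and A
  proof -
    interpret M: prob_space \<mu> by fact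
    interpret N: prob_space \<nu> by fact
    define S where "S = q ` A - {out}"
    have S: "finite S" "S \<subseteq> J" unfolding S_def using J by (auto intro: finite_subset)
    have U: "measure R (\<Union>j\<in>S. q -` {j}) = (\<Sum>j\<in>S. measure R (q -` {j}))"
      if R: "prob_space R" "sets R = sets borel" for R :: "'a measure"
    proof -
      interpret R: prob_space R by fact
      show ?thesis
        by (rule R.finite_measure_finite_Union[OF S(1)])
           (use S J R in \<open>auto simp: disjoint_family_on_def\<close>)
    qed
    have mS: "(\<Union>j\<in>S. q -` {j}) \<in> sets borel" using S J by (intro sets.finite_UN) auto
    have "measure \<mu> A \<le> measure \<mu> ((\<Union>j\<in>S. q -` {j}) \<union> q -` {out})"
      using mS J out \<mu> by (intro M.finite_measure_mono sets.Un) (auto simp: S_def)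
    also have "\<dots> \<le> measure \<mu> (\<Union>j\<in>S. q -` {j}) + measure \<mu> (q -` {out})"
      using mS J out \<mu> by (intro measure_Un_le) auto
    also have "measure \<mu> (\<Union>j\<in>S. q -` {j}) = measure \<nu> (\<Union>j\<in>S. q -` {j})"
      unfolding U[OF \<mu>] U[OF \<nu>] using eq S by (intro sum.cong) auto
    also have "\<dots> \<le> measure \<nu> {x. \<exists>a\<in>A. nrm (x - a) < \<delta>}"
    proof (rule N.finite_measure_mono)
      show "(\<Union>j\<in>S. q -` {j}) \<subseteq> {x. \<exists>a\<in>A. nrm (x - a) < \<delta>}"
        using diam by (fastforce simp: S_def)
      show "{x. \<exists>a\<in>A. nrm (x - a) < \<delta>} \<in> sets \<nu>"
        using open_enlargement \<nu> by simp
    qed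
    finally show ?thesis using o by simp
  qed
  have "\<delta> \<in> {e. e > 0 \<and> (\<forall>A\<in>sets borel.
      measure \<mu> A \<le> measure \<nu> {x. \<exists>a\<in>A. nrm (x - a) < e} + e \<and>
      measure \<nu> A \<le> measure \<mu> {x. \<exists>a\<in>A. nrm (x - a) < e} + e)}"
    using one[OF \<mu> \<nu> eq] one[OF \<nu> \<mu> eq[symmetric]] eq[OF out(1)] out \<delta> by auto
  then show ?thesis
    unfolding LP_def by (intro cInf_lower bdd_belowI[of _ 0]) auto
qed

lemma LP_less_D:
  assumes \<mu>: "prob_space \<mu>" and \<nu>: "prob_space \<nu>" and LP: "LP nrm \<mu> \<nu> < \<delta>"
  shows "\<exists>e>0. e < \<delta> \<and> (\<forall>A\<in>sets borel. measure \<mu> A \<le> measure \<nu> {x. \<exists>a\<in>A. nrm (x - a) < e} + e \<and>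
      measure \<nu> A \<le> measure \<mu> {x. \<exists>a\<in>A. nrm (x - a) < e} + e)"
proof -
  let ?S = "{e. e > 0 \<and> (\<forall>A\<in>sets borel.
      measure \<mu> A \<le> measure \<nu> {x. \<exists>a\<in>A. nrm (x - a) < e} + e \<and>
      measure \<nu> A \<le> measure \<mu> {x. \<exists>a\<in>A. nrm (x - a) < e} + e)}"
  have "1 \<in> ?S"
    using prob_space.prob_le_1[OF \<mu>] prob_space.prob_le_1[OF \<nu>]
    by (auto intro!: add_increasing)
  then have "?S \<noteq> {}" by blast
  moreover have "bdd_below ?S" by (intro bdd_belowI[of _ 0]) auto
  ultimately obtain e where "e \<in> ?S" "e < \<delta>"
    using LP unfolding LP_def by (subst (asm) cInf_less_iff) auto
  then show ?thesis by blast
qed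

end

text \<open>
  The average of the first \<open>n\<close> level indicators approximates \<open>y\<close> from above up to
  \<open>1 / n\<close>: the levels strictly below \<open>y\<close> are those with index less than the ceiling of
  \<open>n * y\<close>.
\<close>

lemma staircase_count:
  fixes y :: real assumes "0 \<le> y" "n > 0"
  shows "y \<le> 1 \<Longrightarrow> y \<le> (\<Sum>j<n. of_bool (real j / real n < y)) / real n"
    and "(\<Sum>j<n. of_bool (real j / real n < y)) / real n \<le> y + 1 / real n"
proof -
  let ?c = "nat \<lceil>real n * y\<rceil>"
  have lt: "real j / real n < y \<longleftrightarrow> j < ?c" for j
    using assms by (simp add: divide_less_eq mult.commute) linarith
  have "(\<Sum>j<n. of_bool (real j / real n < y)) = real (card {j. j < n \<and> j < ?c})"
    by (simp add: lt of_bool_def sum.If_cases Int_def)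
  also have "{j. j < n \<and> j < ?c} = {..<min n ?c}" by auto
  finally have s: "(\<Sum>j<n. of_bool (real j / real n < y)) = real (min n ?c)" by simp
  have c: "real n * y \<le> real ?c" "real ?c \<le> real n * y + 1" using assms by (auto simp: of_nat_nat)
  show "y \<le> (\<Sum>j<n. of_bool (real j / real n < y)) / real n" if "y \<le> 1"
  proof -
    have "real n * y \<le> real n" using that by (simp add: mult_left_le)
    then have "real n * y \<le> real (min n ?c)" using c by simp
    then show ?thesis using assms unfolding s by (simp add: field_simps)
  qed
  show "(\<Sum>j<n. of_bool (real j / real n < y)) / real n \<le> y + 1 / real n"
  proof -
    have "real (min n ?c) \<le> real n * y + 1" using c(2) by (rule order_trans[rotated]) simp
    then show ?thesis using assms unfolding s by (simp add: field_simps)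
  qed
qed

text \<open>
  Apply the enlargement inequality to the superlevel sets of \<open>f\<close>: the enlargement of
  \<open>{f > s}\<close> lies in \<open>{f + K * e > s}\<close>. Averaging over the levels \<open>s\<close> of a
  staircase that approximates \<open>f\<close>, and refining it, turns the inequality for sets into one for integrals.
\<close>

lemma enlargement_controls_lipschitz:
  fixes f :: "'a::euclidean_space \<Rightarrow> real"
  assumes \<mu>: "prob_space \<mu>" "sets \<mu> = sets borel" and \<nu>: "prob_space \<nu>" "sets \<nu> = sets borel"
    and f [measurable]: "f \<in> borel_measurable borel" and f01: "\<And>x. 0 \<le> f x" "\<And>x. f x \<le> 1"
    and lip: "\<And>x y. \<bar>f x - f y\<bar> \<le> K * nrm (x - y)" and K: "K \<ge> 0" and e: "e > 0"
    and enl: "\<And>A. A \<in> sets borel \<Longrightarrow> measure \<mu> A \<le> measure \<nu> {x. \<exists>a\<in>A. nrm (x - a) < e} + e"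
  shows "(\<integral>x. f x \<partial>\<mu>) \<le> (\<integral>x. f x \<partial>\<nu>) + K * e + e"
proof -
  interpret M: prob_space \<mu> by fact
  interpret N: prob_space \<nu> by fact
  note [measurable_cong] = \<mu>(2) \<nu>(2)
  have fM: "integrable \<mu> f" and fN: "integrable \<nu> f"
    using f01 by (auto intro!: M.integrable_const_bound[where B=1] N.integrable_const_bound[where B=1])
  have step: "(\<integral>x. f x \<partial>\<mu>) \<le> (\<integral>x. f x \<partial>\<nu>) + K * e + e + 1 / real n" if n: "n > 0" for n :: nat
  proof -
    let ?g = "\<lambda>x. f x + K * e"
    have level: "measure \<mu> {x. real j / real n < f x} \<le> measure \<nu> {x. real j / real n < ?g x} + e" for j
    proof -
      have "measure \<mu> {x. real j / real n < f x} \<le>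
          measure \<nu> {x. \<exists>a\<in>{x. real j / real n < f x}. nrm (x - a) < e} + e"
        by (rule enl) measurable
      also have "measure \<nu> {x. \<exists>a\<in>{x. real j / real n < f x}. nrm (x - a) < e} \<le>
          measure \<nu> {x. real j / real n < ?g x}"
      proof (rule N.finite_measure_mono)
        show "{x. \<exists>a\<in>{x. real j / real n < f x}. nrm (x - a) < e} \<subseteq> {x. real j / real n < ?g x}"
        proof clarsimp
          fix x a assume a: "real j / real n < f a" "nrm (x - a) < e"
          have "\<bar>f x - f a\<bar> \<le> K * e" using lip[of x a] a(2) K by (meson mult_left_mono order_less_imp_le order_trans)
          then show "real j / real n < f x + K * e" using a by linarith
        qed
      qed measurable
      finally show ?thesis by simp
    qed
    have int: "(\<integral>x. of_bool (c < h x) \<partial>R) = measure R {x. c < h x}"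
        "integrable R (\<lambda>x. of_bool (c < h x) :: real)"
      if "prob_space R" and [measurable_cong]: "sets R = sets borel" and [measurable]: "h \<in> borel_measurable borel"
      for R :: "'a measure" and c and h :: "'a \<Rightarrow> real"
    proof -
      interpret R: prob_space R by fact
      have sp: "space R = UNIV" using sets_eq_imp_space_eq[OF that(2)] by simp
      have *: "(\<lambda>x. of_bool (c < h x)) = (indicator {x. c < h x} :: 'a \<Rightarrow> real)"
        by (auto simp: indicator_def)
      have "{x. c < h x} \<in> sets R" by measurable
      then show "(\<integral>x. of_bool (c < h x) \<partial>R) = measure R {x. c < h x}"
        "integrable R (\<lambda>x. of_bool (c < h x) :: real)"
        unfolding * by (simp_all add: R.emeasure_finite less_top[symmetric] sp)
    qed
    have gm: "?g \<in> borel_measurable borel" by measurable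
    have "(\<integral>x. f x \<partial>\<mu>) \<le> (\<integral>x. (\<Sum>j<n. of_bool (real j / real n < f x)) / real n \<partial>\<mu>)"
      using fM int[OF \<mu> f] f01 n staircase_count(1)
      by (intro integral_mono integrable_divide Bochner_Integration.integrable_sum) auto
    also have "\<dots> = (\<Sum>j<n. measure \<mu> {x. real j / real n < f x}) / real n"
      using int[OF \<mu> f] by (simp del: sum_of_bool_eq)
    also have "\<dots> \<le> (\<Sum>j<n. measure \<nu> {x. real j / real n < ?g x} + e) / real n"
      by (intro divide_right_mono sum_mono level) simp
    also have "\<dots> = (\<Sum>j<n. measure \<nu> {x. real j / real n < ?g x}) / real n + e"
      using n by (simp add: sum.distrib add_divide_distrib)
    also have "(\<Sum>j<n. measure \<nu> {x. real j / real n < ?g x}) / real n =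
        (\<integral>x. (\<Sum>j<n. of_bool (real j / real n < ?g x)) / real n \<partial>\<nu>)"
      using int[OF \<nu> gm] by (simp del: sum_of_bool_eq)
    also have "\<dots> \<le> (\<integral>x. ?g x + 1 / real n \<partial>\<nu>)"
      using fN int[OF \<nu> gm] f01 K e n
      by (intro integral_mono integrable_divide Bochner_Integration.integrable_sum staircase_count(2)) auto
    also have "\<dots> = (\<integral>x. f x \<partial>\<nu>) + K * e + 1 / real n"
      using fN by (simp add: N.prob_space)
    finally show ?thesis by simp
  qed
  have "(\<lambda>n. (\<integral>x. f x \<partial>\<nu>) + K * e + e + 1 / real n) \<longlonglongrightarrow> (\<integral>x. f x \<partial>\<nu>) + K * e + e + 0"
    by (intro tendsto_intros lim_1_over_n)
  then show ?thesis
    using step by (intro LIMSEQ_le_const[where X="\<lambda>n. (\<integral>x. f x \<partial>\<nu>) + K * e + e + 1 / real n"]) (auto intro!: exI[of _ 1])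
qed

section \<open>Noisy laws and laws with small smoothed rate\<close>

lemma borel_probs_UNIV_iff: "Q \<in> borel_probs UNIV \<longleftrightarrow> prob_space Q \<and> sets Q = sets borel"
  by (auto simp: borel_probs_def space_prob_algebra)

context
  fixes Q :: "'a::euclidean_space measure" and \<Xi>
  assumes Q: "Q \<in> borel_probs \<Xi>"
begin

lemma borel_probs_ident_measurable: "(\<lambda>x. x) \<in> Q \<rightarrow>\<^sub>M borel"
proof -
  have "sets Q = sets (restrict_space borel \<Xi>)"
    using Q by (auto simp: borel_probs_def space_prob_algebra)
  then show ?thesis
    by (simp cong: measurable_cong_sets add: measurable_restrict_space1)
qed

lemma space_borel_probs: "space Q = \<Xi>"
proof -
  have "sets Q = sets (restrict_space borel \<Xi>)"
    using Q by (auto simp: borel_probs_def space_prob_algebra)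
  from sets_eq_imp_space_eq[OF this] show ?thesis by (simp add: space_restrict_space)
qed

lemma prob_space_borel_probs: "prob_space Q"
  using Q by (auto simp: borel_probs_def space_prob_algebra)

text \<open>
  A law on \<open>\<Xi>\<close> is regarded as a Borel law on the whole space by pushing it forward along the inclusion,
  which is measurable even if \<open>\<Xi>\<close> is not a Borel set.
\<close>

lemma ambient_law:
  shows "prob_space (distr Q borel (\<lambda>x. x))" "sets (distr Q borel (\<lambda>x. x)) = sets borel"
  using prob_space.prob_space_distr[OF prob_space_borel_probs borel_probs_ident_measurable] by auto

lemma integral_ambient_law:
  fixes g :: "'a \<Rightarrow> 'c::{banach,second_countable_topology}"
  assumes "g \<in> borel_measurable borel"
  shows "(\<integral>x. g x \<partial>distr Q borel (\<lambda>x. x)) = (\<integral>x. g x \<partial>Q)"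
  by (rule integral_distr[OF borel_probs_ident_measurable assms])

lemma noisy_law_eq_convolution:
  assumes E: "E \<in> borel_probs UNIV"
  shows "noisy_law E Q = distr (distr Q borel (\<lambda>x. x) \<Otimes>\<^sub>M E) borel (\<lambda>(x, e). x + e)"
proof -
  interpret E: prob_space E using E by (simp add: borel_probs_UNIV_iff)
  have sE [measurable_cong]: "sets E = sets borel" using E by (simp add: borel_probs_UNIV_iff)
  have s: "sets (noisy_law E Q) = sets borel"
    unfolding noisy_law_def
    by (rule sets_bind) (auto simp: additive_error_def prob_space.not_empty[OF prob_space_borel_probs])
  show ?thesis
  proof (rule measure_eqI)
    fix B assume "B \<in> sets (noisy_law E Q)"
    then have B [measurable]: "B \<in> sets borel" by (simp add: s)
    have "emeasure (noisy_law E Q) B = (\<integral>\<^sup>+\<xi>. (\<integral>\<^sup>+e. indicator B (\<xi> + e) \<partial>E) \<partial>Q)"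
      by (simp add: emeasure_noisy_law[OF E Q B] emeasure_additive_error[OF E B])
    also have "\<dots> = (\<integral>\<^sup>+\<xi>. (\<integral>\<^sup>+e. indicator B (\<xi> + e) \<partial>E) \<partial>distr Q borel (\<lambda>x. x))"
      by (subst nn_integral_distr[OF borel_probs_ident_measurable]) auto
    also have "\<dots> = (\<integral>\<^sup>+z. indicator B (case z of (x, e) \<Rightarrow> x + e) \<partial>(distr Q borel (\<lambda>x. x) \<Otimes>\<^sub>M E))"
      by (subst E.nn_integral_fst[symmetric]) auto
    also have "\<dots> = emeasure (distr (distr Q borel (\<lambda>x. x) \<Otimes>\<^sub>M E) borel (\<lambda>(x, e). x + e)) B"
      by (subst nn_integral_indicator[symmetric], simp, subst nn_integral_distr) auto
    finally show "emeasure (noisy_law E Q) B =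
      emeasure (distr (distr Q borel (\<lambda>x. x) \<Otimes>\<^sub>M E) borel (\<lambda>(x, e). x + e)) B" .
  qed (simp add: s)
qed

lemma noisy_law_prob:
  assumes E: "E \<in> borel_probs UNIV"
  shows "prob_space (noisy_law E Q)" "sets (noisy_law E Q) = sets borel"
proof -
  have sE [measurable_cong]: "sets E = sets borel" and pE: "prob_space E"
    using E by (auto simp: borel_probs_UNIV_iff)
  interpret QE: pair_prob_space "distr Q borel (\<lambda>x. x)" E
    using ambient_law(1) pE
    by (intro pair_prob_space.intro pair_sigma_finite.intro prob_space_imp_sigma_finite)
  show "prob_space (noisy_law E Q)"
    unfolding noisy_law_eq_convolution[OF E] by (rule QE.prob_space_distr) measurable
  show "sets (noisy_law E Q) = sets borel"
    unfolding noisy_law_eq_convolution[OF E] by simp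
qed

lemma char_fun_noisy_law:
  assumes E: "E \<in> borel_probs UNIV"
  shows "char_fun (noisy_law E Q) t = char_fun (distr Q borel (\<lambda>x. x)) t * char_fun E t"
proof -
  have sE [measurable_cong]: "sets E = sets borel" and pE: "prob_space E"
    using E by (auto simp: borel_probs_UNIV_iff)
  interpret QE: pair_prob_space "distr Q borel (\<lambda>x. x)" E
    using ambient_law(1) pE
    by (intro pair_prob_space.intro pair_sigma_finite.intro prob_space_imp_sigma_finite)
  let ?e = "\<lambda>x::'a. exp (\<i> * complex_of_real (t \<bullet> x))"
  have int: "integrable (distr Q borel (\<lambda>x. x) \<Otimes>\<^sub>M E) (\<lambda>(x, e). ?e x * ?e e)"
    by (rule QE.integrable_const_bound[of _ 1]) (auto simp: norm_mult)
  have "char_fun (noisy_law E Q) t = (\<integral>z. (case z of (x, e) \<Rightarrow> ?e x * ?e e) \<partial>(distr Q borel (\<lambda>x. x) \<Otimes>\<^sub>M E))"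
    unfolding char_fun_def noisy_law_eq_convolution[OF E]
    by (subst integral_distr) (auto simp: inner_add_right exp_add distrib_left case_prod_unfold)
  also have "\<dots> = (\<integral>x. (\<integral>e. ?e x * ?e e \<partial>E) \<partial>distr Q borel (\<lambda>x. x))"
    using QE.integral_fst'[OF int] by simp
  also have "\<dots> = char_fun (distr Q borel (\<lambda>x. x)) t * char_fun E t"
    by (simp add: char_fun_def)
  finally show ?thesis .
qed

end

text \<open>
  The infimum in the smoothed rate and the one in the metric need not be attained. As \<open>r\<close> and
  \<open>\<delta>\<close> are positive, some intermediate law has divergence less than \<open>2 * r\<close> and some
  enlargement radius is less than \<open>2 * \<delta>\<close>. The first term bounds the way from the noisy law to the
  intermediate law, the second the way from there to \<open>\<mu>\<close>.
\<close>

lemma smoothed_rate_controls_test: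
  fixes f :: "'a::euclidean_space \<Rightarrow> real"
  assumes nrm: "is_norm nrm" and E: "E \<in> borel_probs UNIV" and Q: "Q \<in> borel_probs \<Xi>"
    and \<mu>: "prob_space \<mu>" "sets \<mu> = sets borel"
    and r: "r > 0" and \<delta>: "\<delta> > 0" and rate: "smoothed_rate nrm E \<delta> \<mu> Q \<le> ereal r"
    and f [measurable]: "f \<in> borel_measurable borel" and f1: "\<And>x. \<bar>f x\<bar> \<le> 1"
    and lip: "\<And>x y. \<bar>f x - f y\<bar> \<le> K * nrm (x - y)" and K: "K \<ge> 0"
  shows "\<bar>(\<integral>x. f x \<partial>noisy_law E Q) - (\<integral>x. f x \<partial>\<mu>)\<bar> \<le> 3 * sqrt (2 * r) + (K + 2) * (2 * \<delta>)"
proof -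
  have "smoothed_rate nrm E \<delta> \<mu> Q < ereal (2 * r)"
    using rate r by (simp add: order_le_less_trans)
  then obtain \<upsilon> where \<upsilon>: "\<upsilon> \<in> borel_probs UNIV" and LP: "LP nrm \<upsilon> \<mu> \<le> \<delta>"
    and kl: "KL \<upsilon> (noisy_law E Q) < ereal (2 * r)"
    unfolding smoothed_rate_def rate_def INF_less_iff by blast
  have U: "prob_space \<upsilon>" "sets \<upsilon> = sets borel" using \<upsilon> by (auto simp: borel_probs_UNIV_iff)
  note N = noisy_law_prob[OF Q E]
  interpret U: prob_space \<upsilon> by fact
  interpret M: prob_space \<mu> by fact
  note [measurable_cong] = U(2) \<mu>(2)
  have 1: "\<bar>(\<integral>x. f x \<partial>\<upsilon>) - (\<integral>x. f x \<partial>noisy_law E Q)\<bar> \<le> 3 * sqrt (2 * r)"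
    using r f f1 N U by (intro KL_controls_total_variation[OF N(1) U(1) _ kl]) (auto cong: measurable_cong_sets)
  obtain e where e: "e > 0" "e < 2 * \<delta>" and
    enl: "\<And>A. A \<in> sets borel \<Longrightarrow> measure \<upsilon> A \<le> measure \<mu> {x. \<exists>a\<in>A. nrm (x - a) < e} + e"
      "\<And>A. A \<in> sets borel \<Longrightarrow> measure \<mu> A \<le> measure \<upsilon> {x. \<exists>a\<in>A. nrm (x - a) < e} + e"
  proof -
    have "LP nrm \<upsilon> \<mu> < 2 * \<delta>" using LP \<delta> by simp
    from LP_less_D[OF nrm U(1) \<mu>(1) this] show ?thesis using that by blast
  qed
  \<comment> \<open>rescaled to take values in the unit interval\<close>
  let ?F = "\<lambda>x. (1 + f x) / 2"
  have F01: "0 \<le> ?F x" "?F x \<le> 1" for x using f1[of x] by auto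
  have Flip: "\<bar>?F x - ?F y\<bar> \<le> K / 2 * nrm (x - y)" for x y
  proof -
    have eq: "?F x - ?F y = (f x - f y) / 2" by (simp add: field_simps)
    show ?thesis using lip[of x y] unfolding eq by simp
  qed
  have Fm: "?F \<in> borel_measurable borel" by measurable
  have fU: "integrable \<upsilon> f" and fM: "integrable \<mu> f"
    using f1 by (auto intro!: U.integrable_const_bound[where B=1] M.integrable_const_bound[where B=1])
  have FU: "(\<integral>x. ?F x \<partial>\<upsilon>) = (1 + (\<integral>x. f x \<partial>\<upsilon>)) / 2" and FM: "(\<integral>x. ?F x \<partial>\<mu>) = (1 + (\<integral>x. f x \<partial>\<mu>)) / 2"
    using fU fM by (simp_all add: U.prob_space M.prob_space)
  have "K / 2 \<ge> 0" using K by simp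
  note shift = enlargement_controls_lipschitz[OF U \<mu> Fm F01 Flip this e(1) enl(1)]
    enlargement_controls_lipschitz[OF \<mu> U Fm F01 Flip this e(1) enl(2)]
  have "(1 + u) / 2 \<le> (1 + v) / 2 + w + e \<Longrightarrow> (1 + v) / 2 \<le> (1 + u) / 2 + w + e \<Longrightarrow>
      \<bar>u - v\<bar> \<le> 2 * (w + e)" for u v w :: real
    unfolding abs_le_iff by (simp add: field_simps)
  from this[OF shift[unfolded FU FM]]
  have "\<bar>(\<integral>x. f x \<partial>\<upsilon>) - (\<integral>x. f x \<partial>\<mu>)\<bar> \<le> 2 * (K / 2 * e + e)" .
  also have "\<dots> = (K + 2) * e" by (simp add: algebra_simps)
  also have "\<dots> \<le> (K + 2) * (2 * \<delta>)" using K e by (intro mult_left_mono) auto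
  finally show ?thesis using 1 by linarith
qed

text \<open>
  The law \<open>\<mu>\<close> serves as a common reference point. The real and imaginary parts of
  \<open>exp (\<i> * (t \<bullet> x))\<close> are test functions with Lipschitz constant \<open>norm t / c\<close>
  with respect to \<open>nrm\<close>.
\<close>

lemma smoothed_rate_controls_char_fun:
  fixes P Q :: "'a::euclidean_space measure"
  assumes nrm: "is_norm nrm" and E: "E \<in> borel_probs UNIV"
    and c: "c > 0" "\<And>x. c * norm x \<le> nrm x"
    and P: "P \<in> borel_probs \<Xi>" and Q: "Q \<in> borel_probs \<Xi>"
    and \<mu>: "prob_space \<mu>" "sets \<mu> = sets borel" and r: "r > 0" and \<delta>: "\<delta> > 0"
    and rate: "smoothed_rate nrm E \<delta> \<mu> P \<le> ereal r" "smoothed_rate nrm E \<delta> \<mu> Q \<le> ereal r"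
  shows "norm (char_fun (noisy_law E Q) t - char_fun (noisy_law E P) t)
    \<le> 4 * (3 * sqrt (2 * r) + (norm t / c + 2) * (2 * \<delta>))"
proof -
  let ?b = "3 * sqrt (2 * r) + (norm t / c + 2) * (2 * \<delta>)"
  have test: "\<bar>(\<integral>x. h (t \<bullet> x) \<partial>noisy_law E Q) - (\<integral>x. h (t \<bullet> x) \<partial>noisy_law E P)\<bar> \<le> 2 * ?b"
    if h [measurable]: "h \<in> borel_measurable borel" and h1: "\<And>u. \<bar>h u\<bar> \<le> 1" and hl: "\<And>u v. \<bar>h u - h v\<bar> \<le> \<bar>u - v\<bar>"
    for h :: "real \<Rightarrow> real"
  proof -
    have lip: "\<bar>h (t \<bullet> x) - h (t \<bullet> y)\<bar> \<le> norm t / c * nrm (x - y)" for x y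
    proof -
      have "\<bar>h (t \<bullet> x) - h (t \<bullet> y)\<bar> \<le> \<bar>t \<bullet> (x - y)\<bar>" using hl by (simp add: inner_diff_right)
      also have "\<dots> \<le> norm t * norm (x - y)" by (rule Cauchy_Schwarz_ineq2)
      also have "\<dots> \<le> norm t * (nrm (x - y) / c)"
        using c(1) c(2)[of "x - y"] by (intro mult_left_mono) (auto simp: field_simps)
      finally show ?thesis by simp
    qed
    have m: "(\<lambda>x. h (t \<bullet> x)) \<in> borel_measurable borel" by measurable
    have "\<bar>(\<integral>x. h (t \<bullet> x) \<partial>noisy_law E R) - (\<integral>x. h (t \<bullet> x) \<partial>\<mu>)\<bar> \<le> ?b"
      if "R \<in> borel_probs \<Xi>" "smoothed_rate nrm E \<delta> \<mu> R \<le> ereal r" for R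
      using smoothed_rate_controls_test[OF nrm E that(1) \<mu> r \<delta> that(2) m h1 lip] c by simp
    note near = this[OF P rate(1)] this[OF Q rate(2)]
    have "\<bar>u - m\<bar> \<le> b \<Longrightarrow> \<bar>v - m\<bar> \<le> b \<Longrightarrow> \<bar>v - u\<bar> \<le> 2 * b" for u v m b :: real by linarith
    from this[OF near] show ?thesis .
  qed
  have cossin: "\<bar>cos u - cos v\<bar> \<le> \<bar>u - v\<bar>" "\<bar>sin u - sin v\<bar> \<le> \<bar>u - v\<bar>" for u v :: real
  proof -
    have "\<bar>sin ((u + v) / 2)\<bar> * \<bar>sin ((v - u) / 2)\<bar> \<le> 1 * \<bar>(v - u) / 2\<bar>"
      by (intro mult_mono abs_sin_x_le_abs_x) auto
    then show "\<bar>cos u - cos v\<bar> \<le> \<bar>u - v\<bar>" by (simp add: cos_diff_cos abs_mult)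
    have "\<bar>sin ((u - v) / 2)\<bar> * \<bar>cos ((u + v) / 2)\<bar> \<le> \<bar>(u - v) / 2\<bar> * 1"
      by (intro mult_mono abs_sin_x_le_abs_x) auto
    then show "\<bar>sin u - sin v\<bar> \<le> \<bar>u - v\<bar>" by (simp add: sin_diff_sin abs_mult)
  qed
  have ReIm: "Re (char_fun R t) = (\<integral>x. cos (t \<bullet> x) \<partial>R)" "Im (char_fun R t) = (\<integral>x. sin (t \<bullet> x) \<partial>R)"
    if "prob_space R" and [measurable_cong]: "sets R = sets borel" for R :: "'a measure"
  proof -
    interpret R: prob_space R by fact
    have "integrable R (\<lambda>x. exp (\<i> * complex_of_real (t \<bullet> x)))"
      by (rule R.integrable_const_bound[where B=1]) auto
    then show "Re (char_fun R t) = (\<integral>x. cos (t \<bullet> x) \<partial>R)" "Im (char_fun R t) = (\<integral>x. sin (t \<bullet> x) \<partial>R)"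
      unfolding char_fun_def by (simp_all add: Re_exp Im_exp flip: integral_Re integral_Im)
  qed
  note NP = noisy_law_prob[OF P E] and NQ = noisy_law_prob[OF Q E]
  have "norm (char_fun (noisy_law E Q) t - char_fun (noisy_law E P) t) \<le> 2 * ?b + 2 * ?b"
    using test[of cos] test[of sin] cossin
    by (intro order_trans[OF cmod_le add_mono]) (simp_all add: ReIm[OF NP] ReIm[OF NQ])
  moreover have "2 * b + 2 * b = 4 * b" for b :: real by simp
  ultimately show ?thesis by (simp only:)
qed

text \<open>
  The deconvolution step. On the set \<open>A n\<close> the factor \<open>char_fun E\<close> is at least
  \<open>1 / (n + 1)\<close> in modulus, so the gap between the noisy characteristic functions is amplified by at most
  \<open>n + 1\<close>; off \<open>A n\<close> the gap is at most two, and that set has small Gaussian measure because the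
  sets \<open>A n\<close> exhaust the space. The index \<open>n\<close> is fixed first and \<open>\<kappa>\<close> is
  chosen afterwards.
\<close>

lemma feasible_laws_agree:
  fixes P :: "'a::euclidean_space measure"
  assumes nrm: "is_norm nrm" and E: "E \<in> borel_probs UNIV" and char_E: "\<And>t. char_fun E t \<noteq> 0"
    and P: "P \<in> borel_probs \<Xi>" and pos: "\<eta> > 0" "L \<ge> 0" "K \<ge> 0"
  shows "\<exists>\<kappa>>0. \<forall>r \<delta> \<mu> Q g. 0 < r \<longrightarrow> r < \<kappa> \<longrightarrow> 0 < \<delta> \<longrightarrow> \<delta> < \<kappa> \<longrightarrow>
      prob_space \<mu> \<longrightarrow> sets \<mu> = sets borel \<longrightarrow> Q \<in> borel_probs \<Xi> \<longrightarrow>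
      smoothed_rate nrm E \<delta> \<mu> P \<le> ereal r \<longrightarrow> smoothed_rate nrm E \<delta> \<mu> Q \<le> ereal r \<longrightarrow>
      (\<forall>x. \<bar>g x\<bar> \<le> L) \<longrightarrow> (\<forall>x y. \<bar>g x - g y\<bar> \<le> K * norm (x - y)) \<longrightarrow>
      \<bar>(\<integral>x. g x \<partial>Q) - (\<integral>x. g x \<partial>P)\<bar> \<le> \<eta>"
proof -
  let ?amb = "\<lambda>R. distr R borel (\<lambda>x::'a. x)"
  interpret G: prob_space "gauss_measure :: 'a measure" by (rule prob_space_gauss_measure)
  have pE: "prob_space E" and sE: "sets E = sets borel"
    using E by (auto simp: borel_probs_UNIV_iff)
  note [measurable] = char_fun_measurable[OF pE sE]
  obtain c where c: "c > 0" "\<And>x. c * norm x \<le> nrm x" using norm_le_nrm[OF nrm] by blast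
  from char_fun_gap_controls_lipschitz_gap[OF ambient_law[OF P] pos]
  obtain s where s: "s > 0" and "\<exists>\<kappa>>0. \<forall>Q g. prob_space Q \<longrightarrow> sets Q = sets borel \<longrightarrow>
      (\<integral>t. norm (char_fun Q (s *\<^sub>R t) - char_fun (?amb P) (s *\<^sub>R t)) \<partial>(gauss_measure :: 'a measure)) \<le> \<kappa> \<longrightarrow>
      (\<forall>x. \<bar>g x\<bar> \<le> L) \<longrightarrow> (\<forall>x y. \<bar>g x - g y\<bar> \<le> K * norm (x - y)) \<longrightarrow>
      \<bar>(\<integral>x. g x \<partial>Q) - (\<integral>x. g x \<partial>?amb P)\<bar> \<le> \<eta>"
    by (elim exE conjE, intro that exI conjI)
  then obtain \<kappa>0 where \<kappa>0: "\<kappa>0 > 0" and deconv: "\<forall>Q g. prob_space Q \<longrightarrow> sets Q = sets borel \<longrightarrow>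
      (\<integral>t. norm (char_fun Q (s *\<^sub>R t) - char_fun (?amb P) (s *\<^sub>R t)) \<partial>(gauss_measure :: 'a measure)) \<le> \<kappa>0 \<longrightarrow>
      (\<forall>x. \<bar>g x\<bar> \<le> L) \<longrightarrow> (\<forall>x y. \<bar>g x - g y\<bar> \<le> K * norm (x - y)) \<longrightarrow>
      \<bar>(\<integral>x. g x \<partial>Q) - (\<integral>x. g x \<partial>?amb P)\<bar> \<le> \<eta>"
    by (elim exE conjE)
  define A where "A = (\<lambda>n::nat. {t. 1 \<le> (real n + 1) * norm (char_fun E (s *\<^sub>R t)) \<and> norm t \<le> real n})"
  have Am: "A n \<in> sets borel" for n unfolding A_def by measurable
  obtain n where n: "(\<integral>t. 1 * indicator (- A n) t \<partial>gauss_measure) < \<kappa>0 / 4"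
  proof -
    have "\<exists>n::nat. (\<integral>t. 1 * indicator (- A n) t \<partial>gauss_measure) < \<kappa>0 / 4"
    proof (rule tail_integral_small)
      show "incseq A"
        unfolding incseq_def
      proof (intro allI impI subsetI)
        fix m n :: nat and t assume mn: "m \<le> n" and t: "t \<in> A m"
        have "(real m + 1) * norm (char_fun E (s *\<^sub>R t)) \<le> (real n + 1) * norm (char_fun E (s *\<^sub>R t))"
          using mn by (intro mult_right_mono) auto
        then show "t \<in> A n" using t mn by (simp add: A_def)
      qed
      show "(\<Union>n. A n) = space gauss_measure"
      proof -
        have "\<exists>n. t \<in> A n" for t
        proof -
          define w where "w = norm (char_fun E (s *\<^sub>R t))"
          have w: "w > 0" using char_E by (simp add: w_def)
          obtain n :: nat where n: "max (norm t) (1 / w) \<le> real n" using real_arch_simple by blast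
          have "1 \<le> real n * w" using n w by (simp add: divide_le_eq)
          also have "\<dots> \<le> (real n + 1) * w" using w by (intro mult_right_mono) auto
          finally have "t \<in> A n" using n by (simp add: A_def w_def)
          then show ?thesis ..
        qed
        then show ?thesis by auto
      qed
    qed (use Am \<kappa>0 in auto)
    then show ?thesis using that by blast
  qed
  define \<beta> where "\<beta> = (\<lambda>\<kappa>. 4 * (3 * sqrt (2 * \<kappa>) + (s * real n / c + 2) * (2 * \<kappa>)))"
  obtain \<kappa> where \<kappa>: "\<kappa> > 0" "(real n + 1) * \<beta> \<kappa> < \<kappa>0 / 2"
  proof -
    have "((\<lambda>\<kappa>. (real n + 1) * \<beta> \<kappa>) \<longlongrightarrow> (real n + 1) * \<beta> 0) (at_right 0)"
      unfolding \<beta>_def by (intro tendsto_intros)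
    then have "eventually (\<lambda>\<kappa>. (real n + 1) * \<beta> \<kappa> < \<kappa>0 / 2) (at_right 0)"
      using \<kappa>0 by (intro order_tendstoD) (auto simp: \<beta>_def)
    then obtain b where "b > 0" "\<And>y. y > 0 \<Longrightarrow> y < b \<Longrightarrow> (real n + 1) * \<beta> y < \<kappa>0 / 2"
      by (auto simp: eventually_at_right_field)
    then show ?thesis using that[of "b / 2"] by simp
  qed
  show ?thesis
  proof (intro exI[of _ \<kappa>] conjI allI impI)
    fix r \<delta> \<mu> Q and g :: "'a \<Rightarrow> real"
    assume r: "0 < r" "r < \<kappa>" and \<delta>: "0 < \<delta>" "\<delta> < \<kappa>" and \<mu>: "prob_space \<mu>" "sets \<mu> = sets borel"
      and Q: "Q \<in> borel_probs \<Xi>" and rate: "smoothed_rate nrm E \<delta> \<mu> P \<le> ereal r" "smoothed_rate nrm E \<delta> \<mu> Q \<le> ereal r"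
      and g: "\<forall>x. \<bar>g x\<bar> \<le> L" "\<forall>x y. \<bar>g x - g y\<bar> \<le> K * norm (x - y)"
    have gm: "g \<in> borel_measurable borel"
    proof (rule borel_measurable_continuous_onI)
      have "K-lipschitz_on UNIV g"
        using g pos by (intro lipschitz_onI) (auto simp: dist_norm dist_real_def)
      then show "continuous_on UNIV g" by (rule lipschitz_on_continuous_on)
    qed
    have pw: "norm (char_fun (?amb Q) (s *\<^sub>R t) - char_fun (?amb P) (s *\<^sub>R t))
        \<le> 2 * (1 * indicator (- A n) t) + (real n + 1) * \<beta> \<kappa>" (is "?d \<le> _") for t
    proof (cases "t \<in> A n")
      case False
      have "?d \<le> 1 + 1"
        using norm_char_fun_le[OF ambient_law(1)[OF P]] norm_char_fun_le[OF ambient_law(1)[OF Q]]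
        by (intro order_trans[OF norm_triangle_ineq4] add_mono) auto
      moreover have "(real n + 1) * \<beta> \<kappa> \<ge> 0"
        unfolding \<beta>_def using \<kappa> s c by (intro mult_nonneg_nonneg add_nonneg_nonneg) auto
      ultimately show ?thesis using False by simp
    next
      case True
      have "norm (char_fun (noisy_law E Q) (s *\<^sub>R t) - char_fun (noisy_law E P) (s *\<^sub>R t))
          \<le> 4 * (3 * sqrt (2 * r) + (norm (s *\<^sub>R t) / c + 2) * (2 * \<delta>))"
        by (rule smoothed_rate_controls_char_fun[OF nrm E c P Q \<mu> r(1) \<delta>(1) rate])
      also have "\<dots> \<le> \<beta> \<kappa>"
        unfolding \<beta>_def using True s c r \<delta>
        by (intro mult_left_mono add_mono mult_mono divide_right_mono) (auto simp: A_def)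
      also have "char_fun (noisy_law E Q) (s *\<^sub>R t) - char_fun (noisy_law E P) (s *\<^sub>R t) =
          (char_fun (?amb Q) (s *\<^sub>R t) - char_fun (?amb P) (s *\<^sub>R t)) * char_fun E (s *\<^sub>R t)"
        by (simp add: char_fun_noisy_law[OF Q E] char_fun_noisy_law[OF P E] left_diff_distrib)
      finally have dE: "?d * norm (char_fun E (s *\<^sub>R t)) \<le> \<beta> \<kappa>" by (simp only: norm_mult)
      have "?d * 1 \<le> ?d * ((real n + 1) * norm (char_fun E (s *\<^sub>R t)))"
        using True by (intro mult_left_mono) (auto simp: A_def)
      also have "\<dots> = (real n + 1) * (?d * norm (char_fun E (s *\<^sub>R t)))" by (simp only: mult_ac)
      also have "\<dots> \<le> (real n + 1) * \<beta> \<kappa>" using dE by (intro mult_left_mono) auto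
      finally have "?d \<le> (real n + 1) * \<beta> \<kappa>" by (simp only: mult_1_right)
      then show ?thesis using True by simp
    qed
    have iA: "integrable gauss_measure (\<lambda>t. 1 * indicator (- A n) t :: real)"
      using Am by (intro G.integrable_const_bound[where B=1]) (auto simp: indicator_def)
    have "(\<integral>t. norm (char_fun (?amb Q) (s *\<^sub>R t) - char_fun (?amb P) (s *\<^sub>R t)) \<partial>gauss_measure) \<le>
        (\<integral>t. 2 * (1 * indicator (- A n) t) + (real n + 1) * \<beta> \<kappa> \<partial>gauss_measure)"
      using integrable_diff_char_fun[OF G.prob_space_axioms _ ambient_law[OF P] ambient_law[OF Q]] iA pw
      by (intro integral_mono) auto
    also have "\<dots> = 2 * (\<integral>t. 1 * indicator (- A n) t \<partial>gauss_measure) + (real n + 1) * \<beta> \<kappa>"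
      using iA by (subst Bochner_Integration.integral_add) (auto simp: G.prob_space[simplified])
    also have "\<dots> \<le> \<kappa>0" using n \<kappa> by linarith
    finally show "\<bar>(\<integral>x. g x \<partial>Q) - (\<integral>x. g x \<partial>P)\<bar> \<le> \<eta>"
      using deconv[rule_format, OF ambient_law[OF Q] _ g[rule_format]]
      by (simp add: integral_ambient_law[OF Q gm] integral_ambient_law[OF P gm])
  qed fact
qed

section \<open>Quantization and the chi-square statistic\<close>

text \<open>
  A grid of cubes with side proportional to \<open>\<delta>\<close>, labelled by the integer parts of the rescaled
  coordinates; \<open>None\<close> labels all points outside a box whose radius is of the order
  \<open>R = \<delta> powr (-1/2)\<close>. This radius makes \<open>\<delta>\<^sup>2 * nrm x ^ 4\<close> at least one in the outer cell,
  so that its mass is of the order \<open>\<delta>\<^sup>2\<close> under a law with a fourth moment, and it keeps the number of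
  cubes per coordinate of the order \<open>R / \<delta> = \<delta> powr (-3/2)\<close>.
\<close>

lemma quantizer_exists:
  fixes nrm :: "'a::euclidean_space \<Rightarrow> real"
  assumes nrm: "is_norm nrm"
  shows "\<exists>B>0. \<forall>\<delta>. 0 < \<delta> \<longrightarrow> \<delta> \<le> 1 \<longrightarrow> (\<exists>(q :: 'a \<Rightarrow> ('a \<Rightarrow> int) option) J.
      finite J \<and> (\<forall>x. q x \<in> J) \<and> None \<in> J \<and> (\<forall>j. q -` {j} \<in> sets borel) \<and>
      (\<forall>x y. q x = q y \<longrightarrow> q x \<noteq> None \<longrightarrow> nrm (x - y) < \<delta>) \<and>
      (\<forall>x. q x = None \<longrightarrow> 1 \<le> \<delta>\<^sup>2 * nrm x ^ 4) \<and>
      real (card J) \<le> B * \<delta> powr (- 3 * real DIM('a) / 2))"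
proof -
  obtain C where C: "C > 0" "\<And>x. nrm x \<le> C * norm x" using nrm_le_norm[OF nrm] by blast
  obtain c where c: "c > 0" "\<And>x. c * norm x \<le> nrm x" using norm_le_nrm[OF nrm] by blast
  define d where "d = real DIM('a)"
  have d: "d > 0" by (simp add: d_def)
  define b where "b = 2 * (C * d / c + 2) + 1"
  have b: "b > 0" using C c d unfolding b_def by (intro add_pos_pos mult_pos_pos) auto
  show ?thesis
  proof (intro exI[of _ "b ^ DIM('a) + 1"] conjI allI impI)
    show "b ^ DIM('a) + 1 > 0" using b by (intro add_pos_pos zero_less_power) auto
    fix \<delta> :: real assume \<delta>: "0 < \<delta>" "\<delta> \<le> 1"
    define R where "R = \<delta> powr (-1/2)"
    have R: "R > 0" using \<delta> by (simp add: R_def)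
    have R4: "\<delta>\<^sup>2 * R ^ 4 = 1"
    proof -
      have "R ^ 4 = \<delta> powr (-2)" using \<delta> by (simp add: R_def powr_power)
      also have "\<dots> = 1 / \<delta>\<^sup>2" using \<delta> by (simp add: powr_minus powr_numeral divide_inverse)
      finally show ?thesis using \<delta> by simp
    qed
    define h where "h = \<delta> / (C * d)"
    have h: "h > 0" using \<delta> C d by (simp add: h_def)
    \<comment> \<open>the additional 1 compensates rounding down at the negative end of the range\<close>
    define m where "m = nat \<lceil>R / (c * h)\<rceil> + 1"
    have m: "R / (c * h) \<le> real m - 1" "real m \<le> R / (c * h) + 2"
    proof -
      have "R / (c * h) > 0" using R c h by simp
      then have "real m = real_of_int \<lceil>R / (c * h)\<rceil> + 1" by (simp add: m_def of_nat_nat)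
      then show "R / (c * h) \<le> real m - 1" "real m \<le> R / (c * h) + 2"
        using of_int_ceiling_le_add_one[of "R / (c * h)"] le_of_int_ceiling[of "R / (c * h)"] by linarith+
    qed
    define w where "w = (\<lambda>x::'a. \<lambda>b\<in>Basis. \<lfloor>(x \<bullet> b) / h\<rfloor>)"
    define I where "I = (PiE (Basis::'a set) (\<lambda>_. {- int m..int m}))"
    define q where "q = (\<lambda>x. if w x \<in> I then Some (w x) else None)"
    define J where "J = insert None (Some ` I)"
    have fI: "finite I" unfolding I_def by (intro finite_PiE) auto
    have wm: "{x. w x = j} \<in> sets borel" for j
    proof (cases "j \<in> extensional Basis")
      case True
      then have "{x. w x = j} = (\<Inter>b\<in>Basis. {x. \<lfloor>(x \<bullet> b) / h\<rfloor> = j b})"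
        by (auto simp: w_def extensional_def fun_eq_iff restrict_def)
      also have "\<dots> \<in> sets borel"
        by (intro sets.countable_INT'' ballI) (auto simp: countable_finite)
      finally show ?thesis .
    next
      case False
      then have "{x. w x = j} = {}" by (auto simp: w_def)
      then show ?thesis by simp
    qed
    have qm: "q -` {j} \<in> sets borel" for j
    proof (cases j)
      case None
      have "q -` {j} = UNIV - (\<Union>i\<in>I. {x. w x = i})" by (auto simp: q_def None)
      also have "\<dots> \<in> sets borel" using wm fI by (intro sets.Diff sets.finite_UN) auto
      finally show ?thesis .
    next
      case (Some i)
      have "q -` {j} = (if i \<in> I then {x. w x = i} else {})" by (auto simp: q_def Some split: if_splits)
      then show ?thesis using wm by auto
    qed
    have diam: "nrm (x - y) < \<delta>" if q: "q x = q y" "q x \<noteq> None" for x y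
    proof -
      have w: "w x = w y" using q by (auto simp: q_def split: if_splits)
      have "\<bar>(x - y) \<bullet> b\<bar> < h" if "b \<in> Basis" for b
      proof -
        have "\<lfloor>(x \<bullet> b) / h\<rfloor> = \<lfloor>(y \<bullet> b) / h\<rfloor>"
          using fun_cong[OF w, of b] that by (simp add: w_def)
        then have "\<bar>(x \<bullet> b) / h - (y \<bullet> b) / h\<bar> < 1" by linarith
        then have "\<bar>((x - y) \<bullet> b) / h\<bar> < 1" by (simp add: inner_diff_left diff_divide_distrib)
        then show ?thesis using h by (simp add: abs_divide divide_less_eq)
      qed
      then have "(\<Sum>b\<in>Basis. \<bar>(x - y) \<bullet> b\<bar>) < (\<Sum>b\<in>(Basis::'a set). h)"
        by (intro sum_strict_mono) auto
      then have "norm (x - y) < d * h"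
        using norm_le_l1[of "x - y"] by (simp add: d_def)
      then have "C * norm (x - y) < C * (d * h)" using C by simp
      also have "\<dots> = \<delta>" using C d by (simp add: h_def)
      finally show ?thesis using C(2)[of "x - y"] by simp
    qed
    have outer: "1 \<le> \<delta>\<^sup>2 * nrm x ^ 4" if q: "q x = None" for x
    proof -
      have "w x \<notin> I" using q by (auto simp: q_def split: if_splits)
      then obtain b where b: "b \<in> Basis" "\<lfloor>(x \<bullet> b) / h\<rfloor> \<notin> {- int m..int m}"
        unfolding I_def w_def by (auto simp: PiE_iff)
      then have "\<bar>(x \<bullet> b) / h\<bar> > real m - 1" by (auto simp: abs_if) linarith+
      then have "R / (c * h) < \<bar>x \<bullet> b\<bar> / h" using m h by simp
      then have "R < c * \<bar>x \<bullet> b\<bar>" using c h by (simp add: field_simps)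
      also have "\<dots> \<le> c * norm x" using c b by (intro mult_left_mono Basis_le_norm) auto
      also have "\<dots> \<le> nrm x" by (rule c)
      finally have "R ^ 4 \<le> nrm x ^ 4" using R by (intro power_mono) auto
      then have "\<delta>\<^sup>2 * R ^ 4 \<le> \<delta>\<^sup>2 * nrm x ^ 4" by (intro mult_left_mono) auto
      then show ?thesis by (simp add: R4)
    qed
    have card: "real (card J) \<le> (b ^ DIM('a) + 1) * \<delta> powr (- 3 * real DIM('a) / 2)"
    proof -
      define t where "t = \<delta> powr (- 3 / 2)"
      have t1: "t \<ge> 1" unfolding t_def using \<delta> powr_mono'[of "-3/2" 0 \<delta>] by simp
      have td: "t ^ DIM('a) = \<delta> powr (- 3 * real DIM('a) / 2)"
        using \<delta> by (simp add: t_def powr_power mult.commute)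
      have Rt: "R / \<delta> = t"
      proof -
        have "R / \<delta> = \<delta> powr (-1/2) / \<delta> powr 1" using \<delta> by (simp add: R_def)
        also have "\<dots> = \<delta> powr (-1/2 - 1)" by (rule powr_diff[symmetric])
        finally show ?thesis by (simp add: t_def)
      qed
      have "R / (c * h) = (C * d / c) * (R / \<delta>)" using C c d \<delta> by (simp add: h_def)
      then have "R / (c * h) = (C * d / c) * t" by (simp only: Rt)
      then have "2 * real m + 1 \<le> 2 * ((C * d / c) * t + 2) + 1" using m by simp
      also have "\<dots> \<le> b * t" using t1 by (simp add: b_def algebra_simps)
      finally have mb: "2 * real m + 1 \<le> b * t" .
      have "card J \<le> Suc (card I)"
        unfolding J_def using fI by (simp add: card_insert_le_m1 card_image)
      also have "card I = (2 * m + 1) ^ DIM('a)"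
      proof -
        have "nat (2 * int m + 1) = 2 * m + 1" by simp
        then show ?thesis unfolding I_def by (simp add: card_PiE)
      qed
      finally have "real (card J) \<le> real (Suc ((2 * m + 1) ^ DIM('a)))" by (simp only: of_nat_le_iff)
      also have "\<dots> = (2 * real m + 1) ^ DIM('a) + 1" by (simp add: add.commute)
      finally have "real (card J) \<le> (2 * real m + 1) ^ DIM('a) + 1" .
      also have "\<dots> \<le> (b * t) ^ DIM('a) + t ^ DIM('a)"
        using mb t1 by (intro add_mono power_mono one_le_power) auto
      also have "\<dots> = (b ^ DIM('a) + 1) * t ^ DIM('a)"
        by (simp add: power_mult_distrib algebra_simps)
      finally show ?thesis by (simp add: td)
    qed
    show "\<exists>(q :: 'a \<Rightarrow> ('a \<Rightarrow> int) option) J.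
      finite J \<and> (\<forall>x. q x \<in> J) \<and> None \<in> J \<and> (\<forall>j. q -` {j} \<in> sets borel) \<and>
      (\<forall>x y. q x = q y \<longrightarrow> q x \<noteq> None \<longrightarrow> nrm (x - y) < \<delta>) \<and>
      (\<forall>x. q x = None \<longrightarrow> 1 \<le> \<delta>\<^sup>2 * nrm x ^ 4) \<and>
      real (card J) \<le> (b ^ DIM('a) + 1) * \<delta> powr (- 3 * real DIM('a) / 2)"
    proof (intro exI[of _ q] exI[of _ J] conjI)
      show "\<forall>x. q x \<in> J" by (auto simp: q_def J_def)
    qed (use fI qm diam outer card in \<open>auto simp: J_def\<close>)
  qed
qed

lemma integral_cellwise:
  fixes q :: "'a::euclidean_space \<Rightarrow> 'i" and \<phi> :: "'i \<Rightarrow> real"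
  assumes \<nu>: "prob_space \<nu>" "sets \<nu> = sets borel"
    and J: "finite J" "\<And>x. q x \<in> J" "\<And>j. j \<in> J \<Longrightarrow> q -` {j} \<in> sets borel"
  shows "(\<lambda>x. \<phi> (q x)) \<in> borel_measurable borel"
    and "(\<integral>x. \<phi> (q x) \<partial>\<nu>) = (\<Sum>j\<in>J. \<phi> j * measure \<nu> (q -` {j}))"
proof -
  interpret prob_space \<nu> by fact
  have eq: "\<phi> (q x) = (\<Sum>j\<in>J. \<phi> j * indicator (q -` {j}) x)" for x
  proof -
    have "(\<Sum>j\<in>J. \<phi> j * indicator (q -` {j}) x) = (\<Sum>j\<in>J. if q x = j then \<phi> j else 0)"
      by (intro sum.cong) (auto simp: indicator_def)
    then show ?thesis using J by simp
  qed
  have "(\<lambda>x. \<Sum>j\<in>J. \<phi> j * indicator (q -` {j}) x) \<in> borel_measurable borel"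
    using J by (intro borel_measurable_sum borel_measurable_times borel_measurable_indicator) auto
  then show "(\<lambda>x. \<phi> (q x)) \<in> borel_measurable borel" by (simp only: eq)
  have sp: "space \<nu> = UNIV" using sets_eq_imp_space_eq[OF \<nu>(2)] by simp
  have "(\<integral>x. (\<Sum>j\<in>J. \<phi> j * indicator (q -` {j}) x) \<partial>\<nu>) = (\<Sum>j\<in>J. \<phi> j * measure \<nu> (q -` {j}))"
    using J \<nu> by (subst Bochner_Integration.integral_sum)
      (auto simp: sp emeasure_finite less_top[symmetric])
  then show "(\<integral>x. \<phi> (q x) \<partial>\<nu>) = (\<Sum>j\<in>J. \<phi> j * measure \<nu> (q -` {j}))" by (simp only: eq)
qed

text \<open>
  The witness has density \<open>\<mu> C / \<nu> C\<close> on each cell \<open>C\<close> with respect to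
  \<open>\<nu>\<close>, which reproduces the cell masses of \<open>\<mu>\<close>. Cells that are null for
  \<open>\<nu>\<close> are null for \<open>\<mu>\<close> as well, so the convention \<open>x / 0 = 0\<close> gives the
  right values there.
\<close>

lemma chi_square_small_imp_feasible:
  fixes q :: "'a::euclidean_space \<Rightarrow> 'i"
  assumes nrm: "is_norm nrm" and \<nu>: "prob_space \<nu>" "sets \<nu> = sets borel"
    and \<mu>: "prob_space \<mu>" "sets \<mu> = sets borel"
    and J: "finite J" "\<And>x. q x \<in> J" "\<And>j. j \<in> J \<Longrightarrow> q -` {j} \<in> sets borel"
    and out: "out \<in> J" "measure \<mu> (q -` {out}) \<le> \<delta>" and \<delta>: "\<delta> > 0"
    and diam: "\<And>x y. q x = q y \<Longrightarrow> q x \<noteq> out \<Longrightarrow> nrm (x - y) < \<delta>"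
    and null: "\<And>j. j \<in> J \<Longrightarrow> measure \<nu> (q -` {j}) = 0 \<Longrightarrow> measure \<mu> (q -` {j}) = 0"
  shows "\<exists>\<upsilon>\<in>borel_probs UNIV. LP nrm \<upsilon> \<mu> \<le> \<delta> \<and> KL \<upsilon> \<nu> \<le>
    ereal (\<Sum>j\<in>J. (measure \<mu> (q -` {j}) - measure \<nu> (q -` {j}))\<^sup>2 / measure \<nu> (q -` {j}))"
proof -
  let ?m = "\<lambda>j. measure \<mu> (q -` {j})" and ?n = "\<lambda>j. measure \<nu> (q -` {j})"
  interpret N: prob_space \<nu> by fact
  note [measurable_cong] = \<nu>(2)
  define f where "f = (\<lambda>x. ?m (q x) / ?n (q x))"
  define \<upsilon> where "\<upsilon> = density \<nu> f"
  have cell: "?m j / ?n j * ?n j = ?m j" if "j \<in> J" for j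
    using null[OF that] by (cases "?n j = 0") auto
  have fm [measurable]: "f \<in> borel_measurable borel"
    unfolding f_def by (rule integral_cellwise(1)[OF \<nu> J])
  have f0: "f x \<ge> 0" for x by (simp add: f_def)
  have fB: "f x \<le> (\<Sum>j\<in>J. ?m j / ?n j)" for x
    unfolding f_def using J by (intro member_le_sum[where f="\<lambda>j. ?m j / ?n j"]) auto
  have tot: "(\<Sum>j\<in>J. measure \<rho> (q -` {j})) = 1"
    if \<rho>: "prob_space \<rho>" "sets \<rho> = sets borel" for \<rho> :: "'a measure"
    using integral_cellwise(2)[OF \<rho> J, of "\<lambda>_. 1"] by (simp add: prob_space.prob_space[OF \<rho>(1)])
  have "(\<integral>x. f x \<partial>\<nu>) = (\<Sum>j\<in>J. ?m j / ?n j * ?n j)"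
    unfolding f_def by (rule integral_cellwise(2)[OF \<nu> J, where \<phi>="\<lambda>j. ?m j / ?n j"])
  also have "\<dots> = (\<Sum>j\<in>J. ?m j)" by (intro sum.cong refl cell)
  finally have f1: "(\<integral>x. f x \<partial>\<nu>) = 1" using tot[OF \<mu>] by simp
  have fi: "integrable \<nu> f"
    using f0 fB by (intro N.integrable_const_bound[where B="\<Sum>j\<in>J. ?m j / ?n j"]) auto
  have U: "prob_space \<upsilon>" "sets \<upsilon> = sets borel"
  proof -
    have "(\<integral>\<^sup>+x. ennreal (f x) \<partial>\<nu>) = 1"
      using fi f0 f1 by (simp add: nn_integral_eq_integral)
    then show "prob_space \<upsilon>"
      unfolding \<upsilon>_def by (intro prob_spaceI) (simp add: emeasure_density cong: nn_integral_cong)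
    show "sets \<upsilon> = sets borel" by (simp add: \<upsilon>_def \<nu>)
  qed
  have eq: "measure \<upsilon> (q -` {j}) = ?m j" if j: "j \<in> J" for j
  proof -
    let ?g = "\<lambda>i. if i = j then ?m i / ?n i else 0"
    have "emeasure \<upsilon> (q -` {j}) = (\<integral>\<^sup>+x. ennreal (f x) * indicator (q -` {j}) x \<partial>\<nu>)"
      unfolding \<upsilon>_def using J j by (subst emeasure_density) (auto simp: \<nu>)
    also have "\<dots> = (\<integral>\<^sup>+x. ennreal (?g (q x)) \<partial>\<nu>)"
      by (intro nn_integral_cong) (auto simp: f_def indicator_def)
    also have "\<dots> = ennreal (\<integral>x. ?g (q x) \<partial>\<nu>)"
    proof (rule nn_integral_eq_integral)
      show "integrable \<nu> (\<lambda>x. ?g (q x))"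
        using integral_cellwise(1)[OF \<nu> J, of ?g]
      proof (intro N.integrable_const_bound[where B="\<Sum>j\<in>J. ?m j / ?n j"] AE_I2)
        show "norm (?g (q x)) \<le> (\<Sum>j\<in>J. ?m j / ?n j)" for x
          by (rule order_trans[OF _ fB[of x]]) (simp add: f_def)
      qed auto
    qed auto
    also have "(\<integral>x. ?g (q x) \<partial>\<nu>) = (\<Sum>i\<in>J. if i = j then ?m i / ?n i * ?n i else 0)"
      by (subst integral_cellwise(2)[OF \<nu> J, where \<phi>="?g"]) (auto intro!: sum.cong)
    also have "\<dots> = ?m j" using J j cell[OF j] by simp
    finally show ?thesis by (simp add: measure_def)
  qed
  have "KL \<upsilon> \<nu> \<le> ereal ((\<integral>x. (f x)\<^sup>2 \<partial>\<nu>) - 1)"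
    unfolding \<upsilon>_def by (rule KL_density_le_chi_square[OF \<nu>(1) _ f0 fB f1]) measurable
  also have "(\<integral>x. (f x)\<^sup>2 \<partial>\<nu>) - 1 = (\<Sum>j\<in>J. (?m j - ?n j)\<^sup>2 / ?n j)"
  proof -
    have "(\<integral>x. (f x)\<^sup>2 \<partial>\<nu>) = (\<Sum>j\<in>J. (?m j / ?n j)\<^sup>2 * ?n j)"
      unfolding f_def by (rule integral_cellwise(2)[OF \<nu> J, where \<phi>="\<lambda>j. (?m j / ?n j)\<^sup>2"])
    also have "\<dots> = (\<Sum>j\<in>J. (?m j - ?n j)\<^sup>2 / ?n j + 2 * ?m j - ?n j)"
    proof (intro sum.cong refl)
      fix j assume "j \<in> J"
      then show "(?m j / ?n j)\<^sup>2 * ?n j = (?m j - ?n j)\<^sup>2 / ?n j + 2 * ?m j - ?n j"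
        using null by (cases "?n j = 0") (auto simp: power2_eq_square field_simps)
    qed
    also have "\<dots> = (\<Sum>j\<in>J. (?m j - ?n j)\<^sup>2 / ?n j) + 2 * 1 - 1"
      unfolding sum_subtractf sum.distrib tot[OF \<nu>] sum_distrib_left[symmetric] tot[OF \<mu>] ..
    finally show ?thesis by simp
  qed
  finally have "KL \<upsilon> \<nu> \<le> ereal (\<Sum>j\<in>J. (?m j - ?n j)\<^sup>2 / ?n j)" .
  moreover have "LP nrm \<upsilon> \<mu> \<le> \<delta>"
    by (rule LP_le_of_equal_cells[OF nrm U \<mu> J eq out \<delta> diam])
  moreover have "\<upsilon> \<in> borel_probs UNIV" using U by (simp add: borel_probs_UNIV_iff)
  ultimately show ?thesis by blast
qed

section \<open>The true law is feasible with high probability\<close>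

lemma sets_empirical: "sets (empirical N x) = sets borel"
  by (simp add: empirical_def)

lemma prob_space_empirical: "N > 0 \<Longrightarrow> prob_space (empirical N x)"
  unfolding empirical_def
  by (intro prob_space.prob_space_distr prob_space_uniform_count_measure)
     (auto simp: measurable_def space_uniform_count_measure sets_uniform_count_measure)

context
  fixes M :: "'w measure" and X :: "nat \<Rightarrow> 'w \<Rightarrow> 'a::euclidean_space" and \<nu> :: "'a measure"
  assumes M: "prob_space M"
    and indep: "prob_space.indep_vars M (\<lambda>_. borel) X UNIV"
    and law: "\<And>i. distr M borel (X i) = \<nu>"
begin

interpretation prob_space M by (rule M)

lemma sample_measurable [measurable]: "X i \<in> borel_measurable M"
  using indep by (auto simp: indep_vars_def)

lemma sample_law_prob: "prob_space \<nu>" "sets \<nu> = sets borel"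
  using prob_space_distr[OF sample_measurable[of 0]] law[of 0] by auto

lemma indicator_sample:
  assumes B [measurable]: "B \<in> sets borel"
  shows "integrable M (\<lambda>\<omega>. indicator B (X i \<omega>) :: real)" "(\<integral>\<omega>. indicator B (X i \<omega>) \<partial>M) = measure \<nu> B"
proof -
  show "integrable M (\<lambda>\<omega>. indicator B (X i \<omega>) :: real)"
    by (rule integrable_const_bound[where B=1]) auto
  interpret N: prob_space \<nu> by (rule sample_law_prob)
  have "space \<nu> = UNIV" using sets_eq_imp_space_eq[OF sample_law_prob(2)] by simp
  moreover have "(\<integral>\<omega>. indicator B (X i \<omega>) \<partial>M) = (\<integral>x. (indicator B x :: real) \<partial>\<nu>)"
    unfolding law[of i, symmetric] by (rule integral_distr[symmetric]) measurable
  ultimately show "(\<integral>\<omega>. indicator B (X i \<omega>) \<partial>M) = measure \<nu> B" by simp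
qed

text \<open>
  Distinct observations are independent; this makes the mixed terms of the variance vanish below.
\<close>

lemma indicator_sample_product:
  assumes B [measurable]: "B \<in> sets borel" and ik: "i \<noteq> k"
  shows "(\<integral>\<omega>. indicator B (X i \<omega>) * indicator B (X k \<omega>) \<partial>M) = (measure \<nu> B)\<^sup>2"
proof -
  have "indep_vars (\<lambda>_. borel) X {i, k}" by (rule indep_vars_subset[OF indep]) simp
  then have iv: "indep_vars (\<lambda>_. borel) (\<lambda>j \<omega>. indicator B (X j \<omega>) :: real) {i, k}"
    by (rule indep_vars_compose2) measurable
  have "(\<integral>\<omega>. (\<Prod>j\<in>{i, k}. indicator B (X j \<omega>)) \<partial>M) = (\<Prod>j\<in>{i, k}. \<integral>\<omega>. (indicator B (X j \<omega>) :: real) \<partial>M)"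
    by (rule indep_vars_lebesgue_integral[OF _ iv]) (use indicator_sample[OF B] in auto)
  then show ?thesis using ik by (simp add: indicator_sample[OF B] power2_eq_square)
qed

lemma expectation_empirical:
  assumes B: "B \<in> sets borel" and N: "N > 0"
  shows "integrable M (\<lambda>\<omega>. measure (empirical N (\<lambda>i. X i \<omega>)) B)"
    and "(\<integral>\<omega>. measure (empirical N (\<lambda>i. X i \<omega>)) B \<partial>M) = measure \<nu> B"
  using indicator_sample[OF B] N by (simp_all add: measure_empirical[OF N B])

lemma variance_empirical:
  assumes B [measurable]: "B \<in> sets borel" and N: "N > 0"
  defines "D \<equiv> \<lambda>\<omega>. (measure (empirical N (\<lambda>i. X i \<omega>)) B - measure \<nu> B)\<^sup>2"
  shows "integrable M D" and "(\<integral>\<omega>. D \<omega> \<partial>M) \<le> measure \<nu> B / real N"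
proof -
  let ?Y = "\<lambda>i \<omega>. indicator B (X i \<omega>) - measure \<nu> B :: real"
  let ?p = "measure \<nu> B"
  interpret N: prob_space \<nu> by (rule sample_law_prob)
  have p: "0 \<le> ?p" "?p \<le> 1" by auto
  have D: "D = (\<lambda>\<omega>. (\<Sum>i<N. \<Sum>k<N. ?Y i \<omega> * ?Y k \<omega>) / (real N)\<^sup>2)"
  proof
    fix \<omega>
    have "measure (empirical N (\<lambda>i. X i \<omega>)) B - ?p = (\<Sum>i<N. ?Y i \<omega>) / real N"
      using N by (simp add: measure_empirical[OF N B] sum_subtractf diff_divide_distrib)
    then show "D \<omega> = (\<Sum>i<N. \<Sum>k<N. ?Y i \<omega> * ?Y k \<omega>) / (real N)\<^sup>2"
      unfolding D_def by (simp only: power_divide) (simp add: power2_eq_square sum_product)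
  qed
  have YY: "integrable M (\<lambda>\<omega>. ?Y i \<omega> * ?Y k \<omega>)"
    "(\<integral>\<omega>. ?Y i \<omega> * ?Y k \<omega> \<partial>M) = (if i = k then ?p - ?p\<^sup>2 else 0)" for i k
  proof -
    have ii: "integrable M (\<lambda>\<omega>. indicator B (X i \<omega>) * indicator B (X k \<omega>) :: real)"
      by (rule integrable_const_bound[where B=1]) (auto simp: indicator_def)
    have eq: "?Y i \<omega> * ?Y k \<omega> = indicator B (X i \<omega>) * indicator B (X k \<omega>)
        - ?p * indicator B (X i \<omega>) - ?p * indicator B (X k \<omega>) + ?p\<^sup>2" for \<omega>
      by (simp add: algebra_simps power2_eq_square)
    show "integrable M (\<lambda>\<omega>. ?Y i \<omega> * ?Y k \<omega>)"
      unfolding eq using ii indicator_sample(1)[OF B] by auto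
    have "(\<integral>\<omega>. ?Y i \<omega> * ?Y k \<omega> \<partial>M) = (\<integral>\<omega>. indicator B (X i \<omega>) * indicator B (X k \<omega>) \<partial>M) - ?p\<^sup>2"
      unfolding eq using ii indicator_sample[OF B] by (simp add: prob_space power2_eq_square)
    also have "(\<integral>\<omega>. indicator B (X i \<omega>) * indicator B (X k \<omega>) \<partial>M) = (if i = k then ?p else ?p\<^sup>2)"
    proof (cases "i = k")
      case True
      have idem: "indicator B x * indicator B x = (indicator B x :: real)" for x by (simp add: indicator_def)
      show ?thesis by (simp only: True idem indicator_sample(2)[OF B] simp_thms if_True)
    qed (use indicator_sample_product[OF B, of i k] in simp)
    finally show "(\<integral>\<omega>. ?Y i \<omega> * ?Y k \<omega> \<partial>M) = (if i = k then ?p - ?p\<^sup>2 else 0)" by auto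
  qed
  show "integrable M D" unfolding D using YY(1) by auto
  have "(\<integral>\<omega>. D \<omega> \<partial>M) = (\<Sum>i<N. \<Sum>k<N. if i = k then ?p - ?p\<^sup>2 else 0) / (real N)\<^sup>2"
    unfolding D using YY by (simp add: Bochner_Integration.integral_sum)
  also have "\<dots> = (?p - ?p\<^sup>2) / real N"
    using N by (simp add: power2_eq_square)
  also have "\<dots> \<le> ?p / real N" by (intro divide_right_mono) auto
  finally show "(\<integral>\<omega>. D \<omega> \<partial>M) \<le> measure \<nu> B / real N" .
qed

text \<open>
  The three requirements of \<open>chi_square_small_imp_feasible\<close> (a small statistic, a light outer cell, no
  observation in a null cell) are merged into one nonnegative statistic \<open>V\<close> such that \<open>V < 1\<close>
  implies all of them, and Markov's inequality is applied once.
\<close>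

lemma true_law_feasible_whp:
  fixes nrm :: "'a \<Rightarrow> real"
  assumes nrm: "is_norm nrm" and moment: "integrable \<nu> (\<lambda>x. nrm x ^ 4)"
  shows "\<exists>B. \<forall>N \<delta> r. 0 < N \<longrightarrow> 0 < \<delta> \<longrightarrow> \<delta> \<le> 1 \<longrightarrow> 0 < r \<longrightarrow>
    (\<exists>G\<in>sets M. prob G \<ge> 1 - (B * \<delta> powr (- 3 * real DIM('a) / 2) / (real N * r) + (\<integral>x. nrm x ^ 4 \<partial>\<nu>) * \<delta>) \<and>
      (\<forall>\<omega>\<in>G. \<exists>\<upsilon>\<in>borel_probs UNIV. LP nrm \<upsilon> (empirical N (\<lambda>i. X i \<omega>)) \<le> \<delta> \<and> KL \<upsilon> \<nu> \<le> ereal r))"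
proof -
  obtain B where quant: "\<And>\<delta>. 0 < \<delta> \<Longrightarrow> \<delta> \<le> 1 \<Longrightarrow> (\<exists>(q :: 'a \<Rightarrow> ('a \<Rightarrow> int) option) J.
      finite J \<and> (\<forall>x. q x \<in> J) \<and> None \<in> J \<and> (\<forall>j. q -` {j} \<in> sets borel) \<and>
      (\<forall>x y. q x = q y \<longrightarrow> q x \<noteq> None \<longrightarrow> nrm (x - y) < \<delta>) \<and>
      (\<forall>x. q x = None \<longrightarrow> 1 \<le> \<delta>\<^sup>2 * nrm x ^ 4) \<and>
      real (card J) \<le> B * \<delta> powr (- 3 * real DIM('a) / 2))"
    using quantizer_exists[OF nrm] by blast
  show ?thesis
  proof (intro exI[of _ B] allI impI)
    fix N :: nat and \<delta> r :: real
    assume N: "0 < N" and \<delta>: "0 < \<delta>" "\<delta> \<le> 1" and r: "0 < r"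
    obtain q :: "'a \<Rightarrow> ('a \<Rightarrow> int) option" and J where J: "finite J" "\<And>x. q x \<in> J"
      and out: "None \<in> J" and qm: "\<And>j. q -` {j} \<in> sets borel"
      and diam: "\<And>x y. q x = q y \<Longrightarrow> q x \<noteq> None \<Longrightarrow> nrm (x - y) < \<delta>"
      and tail: "\<And>x. q x = None \<Longrightarrow> 1 \<le> \<delta>\<^sup>2 * nrm x ^ 4"
      and card: "real (card J) \<le> B * \<delta> powr (- 3 * real DIM('a) / 2)"
      using quant[OF \<delta>] by blast
    let ?\<mu> = "\<lambda>\<omega>. empirical N (\<lambda>i. X i \<omega>)"
    let ?m = "\<lambda>\<omega> j. measure (?\<mu> \<omega>) (q -` {j})" and ?n = "\<lambda>j. measure \<nu> (q -` {j})"
    let ?J0 = "{j \<in> J. ?n j = 0}"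
    let ?K = "\<integral>x. nrm x ^ 4 \<partial>\<nu>"
    interpret N: prob_space \<nu> by (rule sample_law_prob)
    have spN: "space \<nu> = UNIV" using sets_eq_imp_space_eq[OF sample_law_prob(2)] by simp
    define chi where "chi = (\<lambda>\<omega>. \<Sum>j\<in>J. (?m \<omega> j - ?n j)\<^sup>2 / ?n j)"
    \<comment> \<open>an observation in a null cell has empirical mass at least \<open>1 / N\<close>, which makes the last term at least one\<close>
    define V where "V = (\<lambda>\<omega>. chi \<omega> / r + ?m \<omega> None / \<delta> + real N * (\<Sum>j\<in>?J0. ?m \<omega> j))"
    have chi0: "chi \<omega> \<ge> 0" for \<omega> unfolding chi_def by (intro sum_nonneg) simp
    have V0: "V \<omega> \<ge> 0" for \<omega>
      unfolding V_def using chi0 r \<delta> by (intro add_nonneg_nonneg mult_nonneg_nonneg sum_nonneg) auto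
    have chi_i: "integrable M chi"
      unfolding chi_def using variance_empirical(1)[OF qm N] by auto
    have Vi: "integrable M V"
      unfolding V_def using chi_i expectation_empirical(1)[OF qm N] by auto
    have chiE: "(\<integral>\<omega>. chi \<omega> \<partial>M) \<le> real (card J) / real N"
    proof -
      have "(\<integral>\<omega>. chi \<omega> \<partial>M) = (\<Sum>j\<in>J. (\<integral>\<omega>. (?m \<omega> j - ?n j)\<^sup>2 \<partial>M) / ?n j)"
        unfolding chi_def using variance_empirical(1)[OF qm N] by simp
      also have "\<dots> \<le> (\<Sum>j\<in>J. 1 / real N)"
      proof (intro sum_mono)
        fix j
        have "(\<integral>\<omega>. (?m \<omega> j - ?n j)\<^sup>2 \<partial>M) / ?n j \<le> (?n j / real N) / ?n j"
          using variance_empirical(2)[OF qm N] by (intro divide_right_mono) auto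
        also have "\<dots> \<le> 1 / real N" using N by (cases "?n j = 0") auto
        finally show "(\<integral>\<omega>. (?m \<omega> j - ?n j)\<^sup>2 \<partial>M) / ?n j \<le> 1 / real N" .
      qed
      finally show ?thesis by simp
    qed
    have outE: "?n None \<le> ?K * \<delta>\<^sup>2"
    proof -
      have "?n None = (\<integral>x. indicator (q -` {None}) x \<partial>\<nu>)" by (simp add: spN)
      also have "\<dots> \<le> (\<integral>x. \<delta>\<^sup>2 * nrm x ^ 4 \<partial>\<nu>)"
      proof (rule integral_mono)
        show "integrable \<nu> (indicator (q -` {None}) :: 'a \<Rightarrow> real)"
          using qm by (auto simp: sample_law_prob spN N.emeasure_finite less_top[symmetric])
      qed (use moment tail in \<open>auto simp: indicator_def\<close>)
      finally show ?thesis by (simp add: mult.commute)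
    qed
    have "(\<integral>\<omega>. V \<omega> \<partial>M) = (\<integral>\<omega>. chi \<omega> \<partial>M) / r + ?n None / \<delta> + real N * (\<Sum>j\<in>?J0. ?n j)"
      unfolding V_def using chi_i expectation_empirical[OF qm N] by simp
    also have "(\<Sum>j\<in>?J0. ?n j) = 0" by (intro sum.neutral) auto
    also have "(\<integral>\<omega>. chi \<omega> \<partial>M) / r + ?n None / \<delta> + real N * 0 \<le>
        (B * \<delta> powr (- 3 * real DIM('a) / 2) / real N) / r + (?K * \<delta>\<^sup>2) / \<delta>"
    proof -
      have "(\<integral>\<omega>. chi \<omega> \<partial>M) \<le> B * \<delta> powr (- 3 * real DIM('a) / 2) / real N"
        using order_trans[OF chiE divide_right_mono[OF card]] by simp
      then have "(\<integral>\<omega>. chi \<omega> \<partial>M) / r \<le> (B * \<delta> powr (- 3 * real DIM('a) / 2) / real N) / r"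
        using r by (intro divide_right_mono) auto
      moreover have "?n None / \<delta> \<le> (?K * \<delta>\<^sup>2) / \<delta>"
        using outE \<delta> by (intro divide_right_mono) auto
      ultimately show ?thesis by linarith
    qed
    also have "\<dots> = B * \<delta> powr (- 3 * real DIM('a) / 2) / (real N * r) + ?K * \<delta>"
      using \<delta> by (simp add: power2_eq_square)
    finally have EV: "(\<integral>\<omega>. V \<omega> \<partial>M) \<le> B * \<delta> powr (- 3 * real DIM('a) / 2) / (real N * r) + ?K * \<delta>" .
    have Vm: "V \<in> borel_measurable M" using Vi by (rule borel_measurable_integrable)
    define G where "G = {\<omega>\<in>space M. V \<omega> < 1}"
    have G: "G \<in> sets M" unfolding G_def using Vm by measurable
    have "prob {\<omega>\<in>space M. V \<omega> \<ge> 1} \<le> (\<integral>\<omega>. V \<omega> \<partial>M) / 1"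
      by (rule integral_Markov_inequality_measure[OF Vi sets.empty_sets]) (use V0 in auto)
    moreover have "{\<omega>\<in>space M. V \<omega> \<ge> 1} = space M - G" by (auto simp: G_def)
    ultimately have prob_G: "prob G \<ge> 1 - (\<integral>\<omega>. V \<omega> \<partial>M)" using prob_compl[OF G] by simp
    show "\<exists>G\<in>sets M. prob G \<ge> 1 - (B * \<delta> powr (- 3 * real DIM('a) / 2) / (real N * r) + ?K * \<delta>) \<and>
      (\<forall>\<omega>\<in>G. \<exists>\<upsilon>\<in>borel_probs UNIV. LP nrm \<upsilon> (?\<mu> \<omega>) \<le> \<delta> \<and> KL \<upsilon> \<nu> \<le> ereal r)"
    proof (intro bexI[OF _ G] conjI ballI)
      show "prob G \<ge> 1 - (B * \<delta> powr (- 3 * real DIM('a) / 2) / (real N * r) + ?K * \<delta>)"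
        using prob_G EV by linarith
      fix \<omega> assume "\<omega> \<in> G"
      then have V1: "V \<omega> < 1" by (simp add: G_def)
      have S0: "(\<Sum>j\<in>?J0. ?m \<omega> j) \<ge> 0" by (intro sum_nonneg) auto
      have parts: "chi \<omega> / r \<ge> 0" "?m \<omega> None / \<delta> \<ge> 0" "real N * (\<Sum>j\<in>?J0. ?m \<omega> j) \<ge> 0"
        using chi0 r \<delta> S0 by auto
      have chi_r: "chi \<omega> \<le> r"
      proof -
        have "chi \<omega> / r < 1" using V1 parts unfolding V_def by linarith
        then show ?thesis using r by simp
      qed
      have out_\<delta>: "?m \<omega> None \<le> \<delta>"
      proof -
        have "?m \<omega> None / \<delta> < 1" using V1 parts unfolding V_def by linarith
        then show ?thesis using \<delta> by simp
      qed
      have null: "?m \<omega> j = 0" if j: "j \<in> J" "?n j = 0" for j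
      proof -
        have "?m \<omega> j \<le> (\<Sum>j\<in>?J0. ?m \<omega> j)" using j J by (intro member_le_sum) auto
        then have "real N * ?m \<omega> j \<le> real N * (\<Sum>j\<in>?J0. ?m \<omega> j)" by (intro mult_left_mono) auto
        also have "\<dots> < 1" using V1 parts unfolding V_def by linarith
        finally have "(\<Sum>i<N. indicator (q -` {j}) (X i \<omega>)) < (1::real)"
          using N by (simp add: measure_empirical[OF N qm])
        also have "(\<Sum>i<N. indicator (q -` {j}) (X i \<omega>)) = real (card {i. i < N \<and> X i \<omega> \<in> q -` {j}})"
          by (simp add: indicator_def sum.If_cases Int_def)
        finally have "card {i. i < N \<and> X i \<omega> \<in> q -` {j}} = 0" by simp
        moreover have "(\<Sum>i<N. indicator (q -` {j}) (X i \<omega>)) = real (card {i. i < N \<and> X i \<omega> \<in> q -` {j}})"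
          by (simp add: indicator_def sum.If_cases Int_def)
        ultimately show ?thesis by (simp add: measure_empirical[OF N qm])
      qed
      obtain \<upsilon> where \<upsilon>: "\<upsilon> \<in> borel_probs UNIV" "LP nrm \<upsilon> (?\<mu> \<omega>) \<le> \<delta>" "KL \<upsilon> \<nu> \<le> ereal (chi \<omega>)"
        using chi_square_small_imp_feasible[OF nrm sample_law_prob prob_space_empirical[OF N] sets_empirical
            J qm out out_\<delta> \<delta>(1) diam null]
        unfolding chi_def by blast
      have "KL \<upsilon> \<nu> \<le> ereal r" using \<upsilon>(3) chi_r by (meson ereal_less_eq(3) order_trans)
      with \<upsilon> show "\<exists>\<upsilon>\<in>borel_probs UNIV. LP nrm \<upsilon> (?\<mu> \<omega>) \<le> \<delta> \<and> KL \<upsilon> \<nu> \<le> ereal r" by blast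
    qed
  qed
qed

end

section \<open>Losses, decisions and the limit\<close>

text \<open>
  The McShane extension, truncated to the range of the bound. It allows losses given on \<open>\<Xi>\<close> to be
  smoothed on the whole space.
\<close>

lemma bounded_lipschitz_extension:
  fixes f :: "'a::euclidean_space \<Rightarrow> real"
  assumes bd: "\<And>x. x \<in> S \<Longrightarrow> \<bar>f x\<bar> \<le> L" and L: "L \<ge> 0" and K: "K \<ge> 0"
    and lip: "\<And>x y. x \<in> S \<Longrightarrow> y \<in> S \<Longrightarrow> \<bar>f x - f y\<bar> \<le> K * norm (x - y)"
  shows "\<exists>g. (\<forall>x\<in>S. g x = f x) \<and> (\<forall>x. \<bar>g x\<bar> \<le> L) \<and> (\<forall>x y. \<bar>g x - g y\<bar> \<le> K * norm (x - y))"
proof (cases "S = {}")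
  case True
  then show ?thesis using L K by (intro exI[of _ "\<lambda>_. 0"]) auto
next
  case False
  define h where "h = (\<lambda>x. INF y\<in>S. f y + K * norm (x - y))"
  have bb: "bdd_below ((\<lambda>y. f y + K * norm (x - y)) ` S)" for x
  proof (intro bdd_belowI2[of _ "- L"])
    fix y assume "y \<in> S"
    then have "- L \<le> f y" using bd[of y] by simp
    moreover have "0 \<le> K * norm (x - y)" using K by simp
    ultimately show "- L \<le> f y + K * norm (x - y)" by linarith
  qed
  have hS: "h x = f x" if x: "x \<in> S" for x
  proof (rule antisym)
    have "h x \<le> f x + K * norm (x - x)" unfolding h_def by (rule cINF_lower[OF bb x])
    then show "h x \<le> f x" by simp
    show "f x \<le> h x" unfolding h_def
    proof (rule cINF_greatest[OF False])
      fix y assume "y \<in> S"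
      then show "f x \<le> f y + K * norm (x - y)" using lip[OF x, of y] by linarith
    qed
  qed
  have hl: "h x \<le> h y + K * norm (x - y)" for x y
  proof -
    have "h x - K * norm (x - y) \<le> (INF u\<in>S. f u + K * norm (y - u))"
    proof (rule cINF_greatest[OF False])
      fix u assume u: "u \<in> S"
      have "h x \<le> f u + K * norm (x - u)" unfolding h_def by (rule cINF_lower[OF bb u])
      also have "\<dots> \<le> f u + K * (norm (x - y) + norm (y - u))"
        using K norm_triangle_ineq[of "x - y" "y - u"] by (intro add_left_mono mult_left_mono) auto
      finally show "h x - K * norm (x - y) \<le> f u + K * norm (y - u)" by (simp add: algebra_simps)
    qed
    also have "\<dots> = h y" by (simp add: h_def)
    finally show ?thesis by simp
  qed
  define g where "g = (\<lambda>x. max (- L) (min L (h x)))"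
  show ?thesis
  proof (intro exI[of _ g] conjI ballI allI)
    show "g x = f x" if "x \<in> S" for x using bd[OF that] by (simp add: g_def hS[OF that])
    show "\<bar>g x\<bar> \<le> L" for x using L by (auto simp: g_def)
    show "\<bar>g x - g y\<bar> \<le> K * norm (x - y)" for x y
    proof -
      have "\<bar>g x - g y\<bar> \<le> \<bar>h x - h y\<bar>" by (auto simp: g_def)
      also have "\<dots> \<le> K * norm (x - y)"
        using hl[of x y] hl[of y x] by (simp add: norm_minus_commute abs_le_iff)
      finally show ?thesis .
    qed
  qed
qed

lemma inner_prob_bounds:
  assumes "prob_space M" "G \<in> sets M" "G \<subseteq> A"
  shows "measure M G \<le> inner_prob M A" "inner_prob M A \<le> 1"
proof -
  interpret prob_space M by fact
  have "bdd_above (measure M ` {B \<in> sets M. B \<subseteq> A})" by (intro bdd_aboveI2[of _ _ 1]) auto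
  then show "measure M G \<le> inner_prob M A"
    unfolding inner_prob_def using assms by (intro cSUP_upper) auto
  show "inner_prob M A \<le> 1"
    unfolding inner_prob_def by (rule cSUP_least) (use assms in auto)
qed

text \<open>
  The lower bounds on \<open>r\<close> and \<open>\<delta>\<close> give at most a constant times
  \<open>N powr (3 * \<gamma>' / 4 - \<gamma>)\<close>, and the exponent is negative because \<open>\<gamma>' < \<gamma>\<close>.
\<close>

lemma cell_count_negligible:
  fixes r \<delta> :: "nat \<Rightarrow> real" and d :: nat
  assumes d: "d > 0" and \<gamma>: "0 < \<gamma>'" "\<gamma>' < \<gamma>"
    and r: "r \<in> \<Omega>(\<lambda>N. real N powr (\<gamma> - 1))" "\<And>N. N > 0 \<Longrightarrow> r N > 0"
    and \<delta>: "\<delta> \<in> \<Omega>(\<lambda>N. real N powr (- \<gamma>' / (2 * real d)))" "\<And>N. N > 0 \<Longrightarrow> \<delta> N > 0"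
  shows "(\<lambda>N. \<delta> N powr (- 3 * real d / 2) / (real N * r N)) \<longlonglongrightarrow> 0"
proof -
  obtain a where a: "a > 0" "eventually (\<lambda>N. norm (r N) \<ge> a * norm (real N powr (\<gamma> - 1))) at_top"
    using r(1) by (rule landau_omega.bigE)
  obtain b where b: "b > 0" "eventually (\<lambda>N. norm (\<delta> N) \<ge> b * norm (real N powr (- \<gamma>' / (2 * real d)))) at_top"
    using \<delta>(1) by (rule landau_omega.bigE)
  let ?k = "b powr (- 3 * real d / 2) / a"
  have "(\<lambda>N. real N powr (- (\<gamma> - 3 * \<gamma>' / 4))) \<longlonglongrightarrow> 0"
    using \<gamma> by (intro tendsto_neg_powr filterlim_real_sequentially) auto
  then have lim: "(\<lambda>N. ?k * real N powr (- (\<gamma> - 3 * \<gamma>' / 4))) \<longlonglongrightarrow> 0"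
    by (rule tendsto_mult_right_zero)
  show ?thesis
  proof (rule tendsto_sandwich[OF _ _ tendsto_const lim])
    show "eventually (\<lambda>N. 0 \<le> \<delta> N powr (- 3 * real d / 2) / (real N * r N)) sequentially"
      using eventually_gt_at_top[of 0] by eventually_elim (use r(2) in \<open>simp add: less_imp_le\<close>)
    show "eventually (\<lambda>N. \<delta> N powr (- 3 * real d / 2) / (real N * r N) \<le> ?k * real N powr (- (\<gamma> - 3 * \<gamma>' / 4))) sequentially"
      using a(2) b(2) eventually_gt_at_top[of 0]
    proof eventually_elim
      case (elim N)
      have rN: "real N * r N \<ge> a * real N powr \<gamma>"
      proof -
        have "a * real N powr \<gamma> = real N * (a * real N powr (\<gamma> - 1))"
          using elim by (simp add: powr_diff)
        also have "\<dots> \<le> real N * r N" using elim r(2)[of N] by (intro mult_left_mono) auto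
        finally show ?thesis .
      qed
      have "\<delta> N powr (- 3 * real d / 2) \<le> (b * real N powr (- \<gamma>' / (2 * real d))) powr (- 3 * real d / 2)"
        using elim \<delta>(2)[of N] b by (intro powr_mono2') auto
      also have "\<dots> = b powr (- 3 * real d / 2) * real N powr (3 * \<gamma>' / 4)"
        using b elim d by (simp add: powr_mult powr_powr mult.commute)
      finally have "\<delta> N powr (- 3 * real d / 2) / (real N * r N) \<le>
          (b powr (- 3 * real d / 2) * real N powr (3 * \<gamma>' / 4)) / (a * real N powr \<gamma>)"
        using rN a elim by (intro frac_le) auto
      also have "\<dots> = ?k * real N powr (- (\<gamma> - 3 * \<gamma>' / 4))"
        by (simp add: powr_diff)
      finally show ?case .
    qed
  qed
qed

lemma feasible_laws_agree_on_losses: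
  fixes P :: "'a::euclidean_space measure" and \<l> :: "'z \<Rightarrow> 'a \<Rightarrow> real"
  assumes nrm: "is_norm nrm" and E: "E \<in> borel_probs UNIV" and char_E: "\<And>t. char_fun E t \<noteq> 0"
    and P: "P \<in> borel_probs \<Xi>"
    and L: "L > 0" "\<And>z \<xi>. z \<in> Z \<Longrightarrow> \<xi> \<in> \<Xi> \<Longrightarrow> \<bar>\<l> z \<xi>\<bar> \<le> L"
    and Lip: "\<L> > 0"
      "\<And>z \<xi>1 \<xi>2. z \<in> Z \<Longrightarrow> \<xi>1 \<in> \<Xi> \<Longrightarrow> \<xi>2 \<in> \<Xi> \<Longrightarrow> \<xi>1 \<noteq> \<xi>2 \<Longrightarrow>
         \<bar>\<l> z \<xi>1 - \<l> z \<xi>2\<bar> / nrm (\<xi>1 - \<xi>2) \<le> \<L>"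
    and \<eta>: "\<eta> > 0"
  shows "\<exists>\<kappa>>0. \<forall>r \<delta> \<mu> Q z. 0 < r \<longrightarrow> r < \<kappa> \<longrightarrow> 0 < \<delta> \<longrightarrow> \<delta> < \<kappa> \<longrightarrow>
      prob_space \<mu> \<longrightarrow> sets \<mu> = sets borel \<longrightarrow> Q \<in> borel_probs \<Xi> \<longrightarrow>
      smoothed_rate nrm E \<delta> \<mu> P \<le> ereal r \<longrightarrow> smoothed_rate nrm E \<delta> \<mu> Q \<le> ereal r \<longrightarrow>
      z \<in> Z \<longrightarrow> \<bar>(\<integral>x. \<l> z x \<partial>Q) - (\<integral>x. \<l> z x \<partial>P)\<bar> \<le> \<eta>"
proof -
  obtain C where C: "C > 0" "\<And>x. nrm x \<le> C * norm x" using nrm_le_norm[OF nrm] by blast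
  let ?K = "\<L> * C"
  have K: "?K \<ge> 0" and L0: "L \<ge> 0" using C Lip L by auto
  from feasible_laws_agree[OF nrm E char_E P \<eta> L0 K]
  obtain \<kappa> where \<kappa>: "\<kappa> > 0" and agree: "\<forall>r \<delta> \<mu> Q g. 0 < r \<longrightarrow> r < \<kappa> \<longrightarrow> 0 < \<delta> \<longrightarrow> \<delta> < \<kappa> \<longrightarrow>
      prob_space \<mu> \<longrightarrow> sets \<mu> = sets borel \<longrightarrow> Q \<in> borel_probs \<Xi> \<longrightarrow>
      smoothed_rate nrm E \<delta> \<mu> P \<le> ereal r \<longrightarrow> smoothed_rate nrm E \<delta> \<mu> Q \<le> ereal r \<longrightarrow>
      (\<forall>x. \<bar>g x\<bar> \<le> L) \<longrightarrow> (\<forall>x y. \<bar>g x - g y\<bar> \<le> ?K * norm (x - y)) \<longrightarrow>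
      \<bar>(\<integral>x. g x \<partial>Q) - (\<integral>x. g x \<partial>P)\<bar> \<le> \<eta>"
    by (elim exE conjE, intro that)
  show ?thesis
  proof (intro exI[of _ \<kappa>] conjI allI impI)
    fix r \<delta> \<mu> Q z
    assume r: "0 < r" "r < \<kappa>" "0 < \<delta>" "\<delta> < \<kappa>" and \<mu>: "prob_space \<mu>" "sets \<mu> = sets borel"
      and Q: "Q \<in> borel_probs \<Xi>" and rate: "smoothed_rate nrm E \<delta> \<mu> P \<le> ereal r" "smoothed_rate nrm E \<delta> \<mu> Q \<le> ereal r"
      and z: "z \<in> Z"
    have lip: "\<bar>\<l> z x - \<l> z y\<bar> \<le> ?K * norm (x - y)" if "x \<in> \<Xi>" "y \<in> \<Xi>" for x y
    proof (cases "x = y")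
      case False
      then have "nrm (x - y) > 0" using nrm is_norm_rules(4)[OF nrm, of "x - y"] by (auto simp: is_norm_def less_le)
      then have "\<bar>\<l> z x - \<l> z y\<bar> \<le> \<L> * nrm (x - y)"
        using Lip(2)[OF z that False] by (simp add: divide_le_eq)
      also have "\<dots> \<le> \<L> * (C * norm (x - y))" using Lip C by (intro mult_left_mono) auto
      finally show ?thesis by simp
    qed simp
    obtain g where g: "\<forall>x\<in>\<Xi>. g x = \<l> z x" "\<forall>x. \<bar>g x\<bar> \<le> L" "\<forall>x y. \<bar>g x - g y\<bar> \<le> ?K * norm (x - y)"
      using bounded_lipschitz_extension[of \<Xi> "\<l> z" L ?K, OF L(2)[OF z] L0 K lip] by blast
    have eq: "(\<integral>x. \<l> z x \<partial>R) = (\<integral>x. g x \<partial>R)" if "R \<in> borel_probs \<Xi>" for R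
      using g(1) by (intro Bochner_Integration.integral_cong) (auto simp: space_borel_probs[OF that])
    show "\<bar>(\<integral>x. \<l> z x \<partial>Q) - (\<integral>x. \<l> z x \<partial>P)\<bar> \<le> \<eta>"
      unfolding eq[OF Q] eq[OF P]
      by (rule agree[rule_format, OF r \<mu> Q rate g(2)[rule_format] g(3)[rule_format]])
  qed (rule \<kappa>)
qed

text \<open>
  If \<open>c\<close> overestimates \<open>v\<close> by at most \<open>\<epsilon>\<close>, then an
  \<open>\<epsilon>\<close>-minimizer of \<open>c\<close> loses one \<open>\<epsilon>\<close> to the approximation and one to the
  minimization. The infimum of \<open>c\<close> is finite, hence such minimizers exist.
\<close>

lemma near_optimal_decision:
  fixes c :: "'z \<Rightarrow> ereal" and v :: "'z \<Rightarrow> real"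
  assumes lower: "\<And>z. z \<in> Z \<Longrightarrow> ereal (v z) \<le> c z" and upper: "\<And>z. z \<in> Z \<Longrightarrow> c z \<le> ereal (v z + \<epsilon>)"
    and bdd: "\<And>z. z \<in> Z \<Longrightarrow> - L \<le> v z" and \<epsilon>: "\<epsilon> > 0" and Z: "z0 \<in> Z"
  shows "arg_eps_inf \<epsilon> Z c \<noteq> {}"
    and "z \<in> arg_eps_inf \<epsilon> Z c \<Longrightarrow> v z \<le> (INF z\<in>Z. v z) + 2 * \<epsilon>"
proof -
  have bb: "bdd_below (v ` Z)" using bdd by (intro bdd_belowI2)
  have "ereal (- L) \<le> (INF z\<in>Z. c z)"
    by (intro INF_greatest order_trans[OF _ lower]) (use bdd in auto)
  moreover have "(INF z\<in>Z. c z) \<le> ereal (v z0 + \<epsilon>)"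
    using Z upper by (intro INF_lower2[of z0]) auto
  ultimately obtain i where i: "(INF z\<in>Z. c z) = ereal i"
    by (cases "INF z\<in>Z. c z") auto
  have "(INF z\<in>Z. c z) < (INF z\<in>Z. c z) + ereal \<epsilon>" using \<epsilon> by (simp add: i)
  then obtain z1 where "z1 \<in> Z" "c z1 < (INF z\<in>Z. c z) + ereal \<epsilon>" by (auto simp: INF_less_iff)
  then show "arg_eps_inf \<epsilon> Z c \<noteq> {}" by (auto simp: arg_eps_inf_def)
  assume "z \<in> arg_eps_inf \<epsilon> Z c"
  then have z: "z \<in> Z" and cz: "c z < ereal (i + \<epsilon>)" by (auto simp: arg_eps_inf_def i)
  have vz: "v z < i + \<epsilon>" using order_le_less_trans[OF lower[OF z] cz] by simp
  have "i - \<epsilon> \<le> (INF z\<in>Z. v z)"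
  proof (rule cINF_greatest)
    fix z assume "z \<in> Z"
    then have "ereal i \<le> ereal (v z + \<epsilon>)" unfolding i[symmetric] using upper by (intro INF_lower2[of z]) auto
    then show "i - \<epsilon> \<le> v z" by simp
  qed (use Z in auto)
  then show "v z \<le> (INF z\<in>Z. v z) + 2 * \<epsilon>" using vz by linarith
qed

theorem theorem2p15:
  fixes \<Xi> :: "'a::euclidean_space set"
    and nrm :: "'a \<Rightarrow> real"
    and E P :: "'a measure"
    and \<P> :: "'a measure set"
    and Z :: "'z set"
    and \<l> :: "'z \<Rightarrow> 'a \<Rightarrow> real"
    and L \<L> \<gamma> \<gamma>' \<epsilon> :: real
    and r \<delta> :: "nat \<Rightarrow> real"
    and M :: "'w measure"
    and X :: "nat \<Rightarrow> 'w \<Rightarrow> 'a"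
    and z :: "nat \<Rightarrow> 'a measure \<Rightarrow> 'z"
  assumes nrm: "is_norm nrm"
    and E: "E \<in> borel_probs UNIV"
    and char_E: "\<And>t. char_fun E t \<noteq> 0"
    and family: "\<P> \<subseteq> borel_probs \<Xi>"
    and P: "P \<in> \<P>"
    and moment: "integrable (noisy_law E P) (\<lambda>x. nrm x ^ 4)"
    and L: "L > 0" "\<And>z \<xi>. z \<in> Z \<Longrightarrow> \<xi> \<in> \<Xi> \<Longrightarrow> \<bar>\<l> z \<xi>\<bar> \<le> L"
    and Lip: "\<L> > 0"
      "\<And>z \<xi>1 \<xi>2. z \<in> Z \<Longrightarrow> \<xi>1 \<in> \<Xi> \<Longrightarrow> \<xi>2 \<in> \<Xi> \<Longrightarrow> \<xi>1 \<noteq> \<xi>2 \<Longrightarrow>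
         \<bar>\<l> z \<xi>1 - \<l> z \<xi>2\<bar> / nrm (\<xi>1 - \<xi>2) \<le> \<L>"
    and \<gamma>: "0 < \<gamma>'" "\<gamma>' < \<gamma>" "\<gamma> < 1"
    and r: "\<And>N. N > 0 \<Longrightarrow> r N > 0" "r \<longlonglongrightarrow> 0"
      "r \<in> \<Omega>(\<lambda>N. real N powr (\<gamma> - 1))"
    and \<delta>: "\<And>N. N > 0 \<Longrightarrow> \<delta> N > 0" "\<delta> \<longlonglongrightarrow> 0"
      "\<delta> \<in> \<Omega>(\<lambda>N. real N powr (- \<gamma>' / (2 * real DIM('a))))"
    and \<epsilon>: "\<epsilon> > 0"
    and M: "prob_space M"
    and indep: "prob_space.indep_vars M (\<lambda>_. borel) X UNIV"
    and law: "\<And>i. distr M borel (X i) = noisy_law E P"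
    and z_in: "\<And>N \<omega>. N > 0 \<Longrightarrow> \<omega> \<in> space M \<Longrightarrow> z N (empirical N (\<lambda>i. X i \<omega>)) \<in> Z"
    and z_opt: "\<And>N \<omega>. N > 0 \<Longrightarrow> \<omega> \<in> space M \<Longrightarrow>
      arg_eps_inf \<epsilon> Z (robust_cost nrm E \<P> \<l> (r N) (\<delta> N) (empirical N (\<lambda>i. X i \<omega>))) \<noteq> {} \<Longrightarrow>
      z N (empirical N (\<lambda>i. X i \<omega>)) \<in>
        arg_eps_inf \<epsilon> Z (robust_cost nrm E \<P> \<l> (r N) (\<delta> N) (empirical N (\<lambda>i. X i \<omega>)))"
  shows "(\<lambda>N. inner_prob M {\<omega> \<in> space M.
      (\<integral>\<xi>. \<l> (z N (empirical N (\<lambda>i. X i \<omega>))) \<xi> \<partial>P)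
        \<le> (INF z'\<in>Z. \<integral>\<xi>. \<l> z' \<xi> \<partial>P) + 2 * \<epsilon>}) \<longlonglongrightarrow> 1"
proof -
  let ?\<nu> = "noisy_law E P" and ?d = "DIM('a)"
  let ?\<mu> = "\<lambda>N \<omega>. empirical N (\<lambda>i. X i \<omega>)"
  let ?v = "\<lambda>z. \<integral>\<xi>. \<l> z \<xi> \<partial>P"
  let ?A = "\<lambda>N. {\<omega> \<in> space M. ?v (z N (?\<mu> N \<omega>)) \<le> (INF z'\<in>Z. ?v z') + 2 * \<epsilon>}"
  have P\<Xi>: "P \<in> borel_probs \<Xi>" using P family by blast
  interpret P: prob_space P by (rule prob_space_borel_probs[OF P\<Xi>])
  have "\<exists>\<kappa>>0. \<forall>r \<delta> \<mu> Q z. 0 < r \<longrightarrow> r < \<kappa> \<longrightarrow> 0 < \<delta> \<longrightarrow> \<delta> < \<kappa> \<longrightarrow>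
      prob_space \<mu> \<longrightarrow> sets \<mu> = sets borel \<longrightarrow> Q \<in> borel_probs \<Xi> \<longrightarrow>
      smoothed_rate nrm E \<delta> \<mu> P \<le> ereal r \<longrightarrow> smoothed_rate nrm E \<delta> \<mu> Q \<le> ereal r \<longrightarrow>
      z \<in> Z \<longrightarrow> \<bar>(\<integral>x. \<l> z x \<partial>Q) - (\<integral>x. \<l> z x \<partial>P)\<bar> \<le> \<epsilon>"
    by (rule feasible_laws_agree_on_losses) (fact nrm E char_E P\<Xi> L Lip \<epsilon>)+
  then obtain \<kappa> where \<kappa>: "\<kappa> > 0" and agree: "\<forall>r \<delta> \<mu> Q z. 0 < r \<longrightarrow> r < \<kappa> \<longrightarrow> 0 < \<delta> \<longrightarrow> \<delta> < \<kappa> \<longrightarrow>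
      prob_space \<mu> \<longrightarrow> sets \<mu> = sets borel \<longrightarrow> Q \<in> borel_probs \<Xi> \<longrightarrow>
      smoothed_rate nrm E \<delta> \<mu> P \<le> ereal r \<longrightarrow> smoothed_rate nrm E \<delta> \<mu> Q \<le> ereal r \<longrightarrow>
      z \<in> Z \<longrightarrow> \<bar>(\<integral>x. \<l> z x \<partial>Q) - (\<integral>x. \<l> z x \<partial>P)\<bar> \<le> \<epsilon>"
    by (elim exE conjE, intro that)
  from true_law_feasible_whp[OF M indep law nrm moment]
  obtain B where whp: "\<forall>N \<delta> r. 0 < N \<longrightarrow> 0 < \<delta> \<longrightarrow> \<delta> \<le> 1 \<longrightarrow> 0 < r \<longrightarrow>
    (\<exists>G\<in>sets M. measure M G \<ge> 1 - (B * \<delta> powr (- 3 * real ?d / 2) / (real N * r) + (\<integral>x. nrm x ^ 4 \<partial>?\<nu>) * \<delta>) \<and>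
      (\<forall>\<omega>\<in>G. \<exists>\<upsilon>\<in>borel_probs UNIV. LP nrm \<upsilon> (?\<mu> N \<omega>) \<le> \<delta> \<and> KL \<upsilon> ?\<nu> \<le> ereal r))"
    by (elim exE, intro that)
  define b where "b = (\<lambda>N. B * (\<delta> N powr (- 3 * real ?d / 2) / (real N * r N)) + (\<integral>x. nrm x ^ 4 \<partial>?\<nu>) * \<delta> N)"
  have v_ge: "- L \<le> ?v z" if z: "z \<in> Z" for z
  proof (cases "integrable P (\<l> z)")
    case True
    then show ?thesis
      using L(2)[OF z] by (intro P.integral_ge_const AE_I2) (auto simp: space_borel_probs[OF P\<Xi>] abs_le_iff minus_le_iff)
  qed (use L(1) in \<open>simp add: not_integrable_integral_eq\<close>)
  have b_lim: "b \<longlonglongrightarrow> 0"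
  proof -
    have "(\<lambda>N. \<delta> N powr (- 3 * real ?d / 2) / (real N * r N)) \<longlonglongrightarrow> 0"
      by (rule cell_count_negligible[OF DIM_positive \<gamma>(1,2) r(3,1) \<delta>(3,1)])
    then have "b \<longlonglongrightarrow> B * 0 + (\<integral>x. nrm x ^ 4 \<partial>?\<nu>) * 0"
      unfolding b_def using \<delta>(2) by (intro tendsto_intros)
    then show ?thesis by simp
  qed
  have main: "1 - b N \<le> inner_prob M (?A N) \<and> inner_prob M (?A N) \<le> 1"
    if N: "N > 0" and small: "\<delta> N < \<kappa>" "\<delta> N \<le> 1" "r N < \<kappa>" for N
  proof -
    obtain G where G: "G \<in> sets M" and G_prob: "measure M G \<ge> 1 - b N"
      and good: "\<And>\<omega>. \<omega> \<in> G \<Longrightarrow> \<exists>\<upsilon>\<in>borel_probs UNIV. LP nrm \<upsilon> (?\<mu> N \<omega>) \<le> \<delta> N \<and> KL \<upsilon> ?\<nu> \<le> ereal (r N)"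
      using whp[rule_format, OF N \<delta>(1)[OF N] small(2) r(1)[OF N]] unfolding b_def times_divide_eq_right by blast
    have "G \<subseteq> ?A N"
    proof
      fix \<omega> assume \<omega>: "\<omega> \<in> G"
      then have sp: "\<omega> \<in> space M" using sets.sets_into_space[OF G] by blast
      let ?c = "robust_cost nrm E \<P> \<l> (r N) (\<delta> N) (?\<mu> N \<omega>)"
      have feas: "smoothed_rate nrm E (\<delta> N) (?\<mu> N \<omega>) P \<le> ereal (r N)"
      proof -
        obtain \<upsilon> where "\<upsilon> \<in> borel_probs UNIV" "LP nrm \<upsilon> (?\<mu> N \<omega>) \<le> \<delta> N" "KL \<upsilon> ?\<nu> \<le> ereal (r N)"
          using good[OF \<omega>] by blast
        then show ?thesis unfolding smoothed_rate_def rate_def by (intro INF_lower2[of \<upsilon>]) auto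
      qed
      have lower: "ereal (?v z) \<le> ?c z" for z
        unfolding robust_cost_def using P feas by (intro SUP_upper) auto
      have upper: "?c z \<le> ereal (?v z + \<epsilon>)" if z: "z \<in> Z" for z
        unfolding robust_cost_def
      proof (rule SUP_least)
        fix Q assume Q: "Q \<in> {Q \<in> \<P>. smoothed_rate nrm E (\<delta> N) (?\<mu> N \<omega>) Q \<le> ereal (r N)}"
        then have "\<bar>(\<integral>x. \<l> z x \<partial>Q) - ?v z\<bar> \<le> \<epsilon>"
          using family
          by (intro agree[rule_format, OF r(1)[OF N] small(3) \<delta>(1)[OF N] small(1)
                prob_space_empirical[OF N] sets_empirical _ feas _ z]) auto
        then show "ereal (\<integral>x. \<l> z x \<partial>Q) \<le> ereal (?v z + \<epsilon>)" by simp
      qed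
      note near = near_optimal_decision[OF lower upper v_ge \<epsilon> z_in[OF N sp]]
      have "z N (?\<mu> N \<omega>) \<in> arg_eps_inf \<epsilon> Z ?c"
        by (rule z_opt[OF N sp]) (rule near(1))
      then show "\<omega> \<in> ?A N" using near(2) sp by simp
    qed
    with inner_prob_bounds[OF M G] G_prob show ?thesis by (blast intro: order_trans)
  qed
  have ev: "eventually (\<lambda>N. N > 0 \<and> \<delta> N < \<kappa> \<and> \<delta> N \<le> 1 \<and> r N < \<kappa>) sequentially"
  proof (intro eventually_conj)
    show "eventually (\<lambda>N. \<delta> N < \<kappa>) sequentially" "eventually (\<lambda>N. r N < \<kappa>) sequentially"
      using \<delta>(2) r(2) \<kappa> by (auto intro: order_tendstoD)
    have "eventually (\<lambda>N. \<delta> N < 1) sequentially" using \<delta>(2) by (auto intro: order_tendstoD)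
    then show "eventually (\<lambda>N. \<delta> N \<le> 1) sequentially" by eventually_elim simp
  qed (rule eventually_gt_at_top)
  show ?thesis
  proof (rule tendsto_sandwich)
    show "eventually (\<lambda>N. 1 - b N \<le> inner_prob M (?A N)) sequentially"
      "eventually (\<lambda>N. inner_prob M (?A N) \<le> 1) sequentially"
      using ev by (eventually_elim, use main in blast)+
    have "(\<lambda>N. 1 - b N) \<longlonglongrightarrow> 1 - 0" by (intro tendsto_intros b_lim)
    then show "(\<lambda>N. 1 - b N) \<longlonglongrightarrow> 1" by simp
    show "(\<lambda>N. 1 :: real) \<longlonglongrightarrow> 1" by simp
  qed
qed

end
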